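(* Let $n\ge 2$, $m=2n$, and let an almost symmetric numerical semigroup $S=S(\mathbf d^{2n})$, minimally generated by $\mathbf d^{2n}=\{d_1,\dots,d_{2n}\}$, be given. With the multisets $\mathfrak L_o,\mathfrak L_e,\mathfrak B_o,\mathfrak B_e,\overline{\mathfrak B}_o,\overline{\mathfrak B}_e$ associated with $S$ as in the context, put $\mathfrak M_{12}=\mathfrak L_e\bigwedge\mathfrak L_o$ and $\mathfrak X_{12}=\left[\mathfrak B_o\bigvee\overline{\mathfrak B}_o\right]\bigwedge\left[\mathfrak B_e\bigvee\overline{\mathfrak B}_e\right]$. Then $$\left[\mathfrak B_o\bigvee\overline{\mathfrak B}_o\right]\setminus\mathfrak X_{12}=\mathfrak L_e\setminus\mathfrak M_{12},\qquad \left[\mathfrak B_e\bigvee\overline{\mathfrak B}_e\right]\setminus\mathfrak X_{12}=\mathfrak L_o\setminus\mathfrak M_{12}.$$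
   Context: Semigroup. Let $d_1<\dots<d_m$ be positive integers with $\gcd(d_1,\dots,d_m)=1$, none a nonnegative integer linear combination of the others, $S=\{\sum_{i=1}^m x_id_i : x_i\in\mathbb Z_{\ge 0}\}$, $F$ the largest integer not in $S$, $\Sigma_m=\sum_{k=1}^m d_k$. Put $S'=\{x\in\mathbb Z : x\notin S,\ x+s\in S \text{ for all } s\in S\setminus\{0\}\}$ and $\Delta_{\mathcal H}=\{h\notin S : F-h\notin S\}$. $S$ is almost symmetric if $S'\setminus\{F\}=\Delta_{\mathcal H}$. Syzygies. Let $k$ be a field of characteristic $0$, and regard $k[z^{d_1},\dots,z^{d_m}]$ as a graded module over $k[X_1,\dots,X_m]$, $\deg X_i=d_i$, via $X_i\mapsto z^{d_i}$. Its Hilbert series is written $\sum_{s\in S}z^s=Q(z)/\prod_{j=1}^m(1-z^{d_j})$ with $Q=1-Q_1+Q_2-\dots+(-1)^{m-1}Q_{m-1}$ and $Q_i(z)=\sum_{j=1}^{\beta_i}z^{C_{j,i}}$ for $1\le i\le m-1$. The summands $z^{C_{j,i}}$ stand for the syzygies of the $i$th kind (those of the $i$th step of the minimal graded free resolution); the positive integers $C_{j,i}$ are the syzygy degrees and the numbers $\beta_i$ of terms the Betti numbers. They are subject to the standing requirements $C_{j+1,i}\ge C_{j,i}$, $C_{\beta_{i+1},i+1}>C_{\beta_i,i}$, $C_{1,i+1}>C_{1,i}$, and $$C_{j,i}\ne C_{r,i+2k-1}\quad\text{for } 1\le j\le\beta_i,\ 1\le r\le\beta_{i+2k-1},\ 1\le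 k\le\lfloor (m-i)/2\rfloor ;$$ the last requirement means that all necessary cancellations of terms $z^{C_{j,i}}$ in the alternating sum $Q$ are already performed. Put $\overline C_{j,i}=F+\Sigma_m-C_{j,i}$. Multiset operations. For finite multisets of integers with multiplicity functions $\sigma_1,\sigma_2$: $\bigvee$ (join) has multiplicity $\sigma_1+\sigma_2$; $\bigwedge$ (intersection) has multiplicity $\min\{\sigma_1,\sigma_2\}$; $\setminus$ (difference, when the second multiset is contained in the first) has multiplicity $\sigma_1-\sigma_2$. Multisets ($m=2n$). For $1\le i\le m-1$ let $\mathfrak L_i$ be the multiset of all integers $\sum_{j\in I}d_j+h$, where $I$ runs over the $i$-element subsets of $\{1,\dots,m\}$ and $h$ over $\Delta_{\mathcal H}$, counted with multiplicity (so it has $\binom mi\cdot\#\Delta_{\mathcal H}$ elements). $\mathfrak L_o$ (resp. $\mathfrak L_e$) is the join of all $\mathfrak L_i$ with $i$ odd (resp. even), $1\le i\le m-1$. Let $\mathfrak B_i=\{C_{j,i}:1\le j\le\beta_i\}$ and $\overline{\mathfrak B}_i=\{\overline C_{j,i}:1\le j\le\beta_i\}$ as multisets. Then $\mathfrak B_o=\bigvee_{i=1}^{n-1}\mathfrak B_{2i-1}$, $\mathfrak B_e=\bigvee_{i=1}^{n-1}\mathfrak B_{2i}$, $\overline{\mathfrak B}_o=\bigvee_{i=1}^{n-1}\overline{\mathfrak B}_{2i-1}$, $\overline{\mathfrak B}_e=\bigvee_{i=1}^{n-1}\overline{\mathfrak B}_{2i}$. *)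

theory Defs
  imports
    "HOL-Library.Multiset"
    "HOL-Library.Poly_Mapping"
    "HOL-Computational_Algebra.Computational_Algebra"
begin

text \<open>Generators are indexed by \<open>{1..m}\<close>; values of \<open>d\<close> outside this range are irrelevant.\<close>

definition minimal_generators :: "nat \<Rightarrow> (nat \<Rightarrow> nat) \<Rightarrow> bool" where
  "minimal_generators m d \<longleftrightarrow>
     (\<forall>i\<in>{1..m}. 0 < d i) \<and>
     strict_mono_on {1..m} d \<and>
     Gcd (d ` {1..m}) = 1 \<and>
     (\<forall>i\<in>{1..m}. \<not> (\<exists>x. d i = (\<Sum>j\<in>{1..m} - {i}. x j * d j)))"

definition semigroup_of :: "nat \<Rightarrow> (nat \<Rightarrow> nat) \<Rightarrow> int set" where
  "semigroup_of m d = {\<Sum>i=1..m. int (x i * d i) | x :: nat \<Rightarrow> nat. True}"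

definition frobenius :: "int set \<Rightarrow> int" where
  "frobenius S = (GREATEST x. x \<notin> S)"

definition pseudo_frobenius :: "int set \<Rightarrow> int set" where
  "pseudo_frobenius S = {x. x \<notin> S \<and> (\<forall>s\<in>S - {0}. x + s \<in> S)}"

definition Delta_H :: "int set \<Rightarrow> int set" where
  "Delta_H S = {h. h \<notin> S \<and> frobenius S - h \<notin> S}"

definition almost_symmetric :: "int set \<Rightarrow> bool" where
  "almost_symmetric S \<longleftrightarrow> pseudo_frobenius S - {frobenius S} = Delta_H S"

definition gen_sum :: "nat \<Rightarrow> (nat \<Rightarrow> nat) \<Rightarrow> nat" where
  "gen_sum m d = (\<Sum>k=1..m. d k)"

text \<open>
  A polynomial is a finitely supported map from exponent vectors to coefficients, and
  \<open>polys m\<close> is \<open>k[X_1, ..., X_m]\<close>.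
\<close>

type_synonym 'k mpolynomial = "(nat \<Rightarrow>\<^sub>0 nat) \<Rightarrow>\<^sub>0 'k"

definition polys :: "nat \<Rightarrow> 'k::field mpolynomial set" where
  "polys m = {p. \<forall>t\<in>Poly_Mapping.keys p. Poly_Mapping.keys t \<subseteq> {1..m}}"

definition wdeg :: "(nat \<Rightarrow> nat) \<Rightarrow> (nat \<Rightarrow>\<^sub>0 nat) \<Rightarrow> nat" where
  "wdeg d t = (\<Sum>i\<in>Poly_Mapping.keys t. Poly_Mapping.lookup t i * d i)"

text \<open>
  The \<open>k\<close>-algebra map \<open>X_i \<mapsto> z^(d_i)\<close> into \<open>k[z]\<close>. The image of \<open>polys m\<close> is the semigroup
  ring \<open>k[z^(d_1), ..., z^(d_m)]\<close>.
\<close>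

definition monomial_map :: "(nat \<Rightarrow> nat) \<Rightarrow> 'k::field mpolynomial \<Rightarrow> 'k poly" where
  "monomial_map d p =
     (\<Sum>t\<in>Poly_Mapping.keys p. monom (Poly_Mapping.lookup p t) (wdeg d t))"

text \<open>The free module of rank \<open>b\<close> over \<open>polys m\<close>, with coordinates indexed by \<open>{1..b}\<close>.\<close>

definition free_module :: "nat \<Rightarrow> nat \<Rightarrow> (nat \<Rightarrow> 'k::field mpolynomial) set" where
  "free_module m b = {v. (\<forall>j\<in>{1..b}. v j \<in> polys m) \<and> (\<forall>j. j \<notin> {1..b} \<longrightarrow> v j = 0)}"

definition mat_apply ::
    "nat \<Rightarrow> nat \<Rightarrow> (nat \<Rightarrow> nat \<Rightarrow> 'k::field mpolynomial) \<Rightarrow>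
     (nat \<Rightarrow> 'k mpolynomial) \<Rightarrow> (nat \<Rightarrow> 'k mpolynomial)" where
  "mat_apply rows cols A v = (\<lambda>r. if r \<in> {1..rows} then \<Sum>j=1..cols. A r j * v j else 0)"

text \<open>
  \<open>0 \<rightarrow> F_(m-1) \<rightarrow> ... \<rightarrow> F_1 \<rightarrow> F_0 \<rightarrow> k[z^(d_1), ..., z^(d_m)] \<rightarrow> 0\<close> is a minimal graded free
  resolution, where \<open>F_i\<close> has \<open>b i\<close> basis elements, the \<open>j\<close>-th of degree \<open>c j i\<close>, the matrix
  \<open>D i\<close> represents \<open>F_(i+1) \<rightarrow> F_i\<close>, \<open>F_0\<close> is the polynomial ring itself, and the augmentation
  is \<open>monomial_map d\<close>. The clauses on the entries of \<open>D i\<close> say that the differential has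
  degree zero and maps into \<open>(X_1, ..., X_m) F_i\<close>.
\<close>

definition minimal_graded_free_resolution ::
    "nat \<Rightarrow> (nat \<Rightarrow> nat) \<Rightarrow> (nat \<Rightarrow> nat) \<Rightarrow> (nat \<Rightarrow> nat \<Rightarrow> nat) \<Rightarrow>
     (nat \<Rightarrow> nat \<Rightarrow> nat \<Rightarrow> 'k::field mpolynomial) \<Rightarrow> bool" where
  "minimal_graded_free_resolution m d b c D \<longleftrightarrow>
     b 0 = 1 \<and> c 1 0 = 0 \<and> (\<forall>i\<ge>m. b i = 0) \<and>
     (\<forall>i. \<forall>r\<in>{1..b i}. \<forall>j\<in>{1..b (Suc i)}.
        D i r j \<in> polys m \<and>
        (\<forall>t\<in>Poly_Mapping.keys (D i r j). wdeg d t + c r i = c j (Suc i)) \<and>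
        Poly_Mapping.lookup (D i r j) 0 = 0) \<and>
     mat_apply (b 0) (b 1) (D 0) ` free_module m (b 1) =
       {v \<in> free_module m (b 0). monomial_map d (v 1) = 0} \<and>
     (\<forall>i. mat_apply (b (Suc i)) (b (Suc (Suc i))) (D (Suc i)) ` free_module m (b (Suc (Suc i))) =
       {v \<in> free_module m (b (Suc i)). mat_apply (b i) (b (Suc i)) (D i) v = (\<lambda>_. 0)})"

text \<open>\<open>C j i\<close> is \<open>C_(j,i)\<close>; only \<open>1 \<le> j \<le> \<beta> i\<close> is relevant.\<close>

definition syz_mset :: "(nat \<Rightarrow> nat) \<Rightarrow> (nat \<Rightarrow> nat \<Rightarrow> nat) \<Rightarrow> nat \<Rightarrow> int multiset" where
  "syz_mset \<beta> C i = image_mset (\<lambda>j. int (C j i)) (mset_set {1..\<beta> i})"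

definition hilbert_series :: "int set \<Rightarrow> rat fps" where
  "hilbert_series S = Abs_fps (\<lambda>s. if int s \<in> S then 1 else 0)"

definition syz_numerator :: "nat \<Rightarrow> (nat \<Rightarrow> nat) \<Rightarrow> (nat \<Rightarrow> nat \<Rightarrow> nat) \<Rightarrow> rat fps" where
  "syz_numerator m \<beta> C = 1 + (\<Sum>i=1..m-1. (-1) ^ i * (\<Sum>j=1..\<beta> i. fps_X ^ C j i))"

definition standing_requirements :: "nat \<Rightarrow> (nat \<Rightarrow> nat) \<Rightarrow> (nat \<Rightarrow> nat \<Rightarrow> nat) \<Rightarrow> bool" where
  "standing_requirements m \<beta> C \<longleftrightarrow>
     (\<forall>i\<in>{1..m-1}. \<forall>j\<in>{1..\<beta> i}. 0 < C j i) \<and>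
     (\<forall>i\<in>{1..m-1}. \<forall>j. 1 \<le> j \<and> j < \<beta> i \<longrightarrow> C j i \<le> C (j + 1) i) \<and>
     (\<forall>i. 1 \<le> i \<and> i < m - 1 \<longrightarrow> C (\<beta> i) i < C (\<beta> (i + 1)) (i + 1) \<and> C 1 i < C 1 (i + 1)) \<and>
     (\<forall>i\<in>{1..m-1}. \<forall>k\<in>{1..(m - i) div 2}.
        \<forall>j\<in>{1..\<beta> i}. \<forall>r\<in>{1..\<beta> (i + 2 * k - 1)}. C j i \<noteq> C r (i + 2 * k - 1))"

text \<open>
  \<open>C\<close> lists the syzygy degrees that enter the numerator of the Hilbert series \<open>Q\<close>: those of the
  \<open>i\<close>-th kind are degrees of the \<open>i\<close>-th step of the minimal graded free resolution
  \<open>(b, c, D)\<close>, with multiplicity. Inclusion instead of equality in the second clause leaves room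
  for equal terms of opposite sign having been cancelled in \<open>Q\<close>, as the last standing requirement
  demands; if the resolution has no such terms, \<open>C\<close> may list all its degrees and \<open>\<beta>\<close> is then
  the sequence of its Betti numbers.
\<close>

definition syzygy_degrees ::
    "nat \<Rightarrow> (nat \<Rightarrow> nat) \<Rightarrow> (nat \<Rightarrow> nat) \<Rightarrow> (nat \<Rightarrow> nat \<Rightarrow> nat) \<Rightarrow>
     (nat \<Rightarrow> nat \<Rightarrow> nat \<Rightarrow> 'k::field mpolynomial) \<Rightarrow>
     (nat \<Rightarrow> nat) \<Rightarrow> (nat \<Rightarrow> nat \<Rightarrow> nat) \<Rightarrow> bool" where
  "syzygy_degrees m d b c D \<beta> C \<longleftrightarrow>
     minimal_graded_free_resolution m d b c D \<and>
     (\<forall>i\<in>{1..m-1}. syz_mset \<beta> C i \<subseteq># syz_mset b c i) \<and>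
     hilbert_series (semigroup_of m d) = syz_numerator m \<beta> C / (\<Prod>j=1..m. 1 - fps_X ^ d j) \<and>
     standing_requirements m \<beta> C"

text \<open>
  Join, intersection and difference of multisets are \<open>+\<close>, \<open>\<inter>#\<close> and \<open>-\<close>; the last one truncates,
  which is immaterial when the second multiset is contained in the first.
\<close>

definition L_mset :: "nat \<Rightarrow> (nat \<Rightarrow> nat) \<Rightarrow> nat \<Rightarrow> int multiset" where
  "L_mset m d i =
     image_mset (\<lambda>(I, h). int (\<Sum>j\<in>I. d j) + h)
       (mset_set ({I. I \<subseteq> {1..m} \<and> card I = i} \<times> Delta_H (semigroup_of m d)))"

definition L_odd :: "nat \<Rightarrow> (nat \<Rightarrow> nat) \<Rightarrow> int multiset" where
  "L_odd m d = (\<Sum>i\<in>{i\<in>{1..m-1}. odd i}. L_mset m d i)"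

definition L_even :: "nat \<Rightarrow> (nat \<Rightarrow> nat) \<Rightarrow> int multiset" where
  "L_even m d = (\<Sum>i\<in>{i\<in>{1..m-1}. even i}. L_mset m d i)"

definition bar :: "nat \<Rightarrow> (nat \<Rightarrow> nat) \<Rightarrow> int \<Rightarrow> int" where
  "bar m d x = frobenius (semigroup_of m d) + int (gen_sum m d) - x"

definition syz_bar_mset ::
    "nat \<Rightarrow> (nat \<Rightarrow> nat) \<Rightarrow> (nat \<Rightarrow> nat) \<Rightarrow> (nat \<Rightarrow> nat \<Rightarrow> nat) \<Rightarrow> nat \<Rightarrow> int multiset" where
  "syz_bar_mset m d \<beta> C i = image_mset (\<lambda>j. bar m d (int (C j i))) (mset_set {1..\<beta> i})"

end

theory Submission
  imports Defs "HOL-Library.Function_Algebras"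
begin

text \<open>
  Every integer \<open>x\<close> satisfies exactly one of \<open>x \<in> S\<close>, \<open>F - x \<in> S\<close>, \<open>x \<in> \<Delta>\<close>. Multiplying the
  resulting identity of generating functions by \<open>\<Prod>(1 - z^(d_j))\<close>, which kills the sum of all
  \<open>z^x\<close>, expresses \<open>Q(z) + z^(F+\<Sigma>) Q(1/z)\<close>, for even \<open>m\<close>, as an alternating sum of the
  multisets \<open>L_i\<close>, \<open>0 \<le> i \<le> m\<close>. The claim follows once \<open>L_0\<close> and \<open>L_m\<close> are seen to cancel against
  \<open>1\<close>, \<open>z^(F+\<Sigma>)\<close> and the syzygies of the last kind, that is, once the degrees of the latter are
  known to be \<open>\<Sigma> + f\<close>, each once, with \<open>f\<close> pseudo-Frobenius (by almost symmetry, \<open>f = F\<close> or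
  \<open>f \<in> \<Delta>\<close>).

  A basis element of degree \<open>x\<close> in step \<open>i\<close> of the resolution gives a nonzero class in the \<open>i\<close>-th
  Koszul homology of the semigroup ring in degree \<open>x\<close>, which is the reduced homology of the
  simplicial complex of all \<open>I\<close> with \<open>x - \<Sum>_(j\<in>I) d_j \<in> S\<close>. For \<open>i = m - 1\<close> this forces the complex
  to be the boundary of the full simplex, so \<open>x - \<Sigma>\<close> is pseudo-Frobenius; conversely for such \<open>x\<close>
  the homology vanishes in the steps \<open>1 \<le> i < m - 1\<close>. Since the coefficient of \<open>z^(\<Sigma>+f)\<close> in \<open>Q\<close>
  is \<open>-1\<close>, this degree occurs exactly once among the last syzygies and is not lost to cancellation.
\<close>

section \<open>The Koszul complex\<close>

text \<open>The sign that arises when \<open>e_l\<close> wedge \<open>e_I\<close> is sorted into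
  increasing order. It acts on a value, not as an integer factor, so that any abelian group can
  carry the coefficients.\<close>

definition ksgn :: "nat \<Rightarrow> nat set \<Rightarrow> 'a::ab_group_add \<Rightarrow> 'a" where
  "ksgn l I a = (if even (card {i\<in>I. i < l}) then a else - a)"

text \<open>
  \<open>w I\<close> is the coefficient of the exterior monomial \<open>e_I\<close>, and \<open>X l\<close> is the action of the
  \<open>l\<close>-th variable on the coefficients.
\<close>

definition koszul ::
    "nat \<Rightarrow> (nat \<Rightarrow> 'a::ab_group_add \<Rightarrow> 'a) \<Rightarrow> (nat set \<Rightarrow> 'a) \<Rightarrow> nat set \<Rightarrow> 'a" where
  "koszul m X w I =
     (if I \<subseteq> {1..m} then \<Sum>l\<in>{1..m} - I. ksgn l I (X l (w (insert l I))) else 0)"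

lemma ksgn_zero [simp]: "ksgn l I 0 = 0"
  by (simp add: ksgn_def)

lemma ksgn_eq_0_iff [simp]: "ksgn l I a = 0 \<longleftrightarrow> a = 0"
  by (simp add: ksgn_def)

lemma ksgn_trivial:
  assumes "\<And>i. i \<in> I \<Longrightarrow> l \<le> i"
  shows "ksgn l I a = a"
proof -
  have none: "{i\<in>I. i < l} = {}" using assms by force
  show ?thesis unfolding ksgn_def none by simp
qed

lemma additive_ksgn:
  assumes "additive f"
  shows "f (ksgn l I a) = ksgn l I (f a)"
  using additive.minus[OF assms] by (simp add: ksgn_def)

lemma ksgn_additive: "additive (ksgn l I)"
  by unfold_locales (simp add: ksgn_def)

lemma koszul_add:
  assumes "\<And>l. additive (X l)"
  shows "koszul m X (\<lambda>I. v I + w I) I = koszul m X v I + koszul m X w I"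
  by (simp add: koszul_def additive.add[OF assms] additive.add[OF ksgn_additive] sum.distrib)

lemma koszul_additive_comm:
  assumes "additive f" and "\<And>l v. f (X l v) = Y l (f v)"
  shows "f (koszul m X w I) = koszul m Y (\<lambda>I. f (w I)) I"
  by (simp add: koszul_def additive.sum[OF assms(1)] additive.zero[OF assms(1)]
      additive_ksgn[OF assms(1)] assms(2))

text \<open>Renaming the indices would only show that twice the sum is zero, which is not enough in
  the presence of 2-torsion. The induction cancels row \<open>a\<close> against column
  \<open>a\<close> directly.\<close>

lemma sum_antisymmetric:
  fixes g :: "'b \<Rightarrow> 'b \<Rightarrow> 'a::ab_group_add"
  assumes "finite A" and "\<And>x y. x \<in> A \<Longrightarrow> y \<in> A \<Longrightarrow> x \<noteq> y \<Longrightarrow> g x y = - g y x"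
  shows "(\<Sum>x\<in>A. \<Sum>y\<in>A - {x}. g x y) = 0"
  using assms
proof (induction A rule: finite_induct)
  case (insert a A)
  have 1: "(\<Sum>y\<in>insert a A - {x}. g x y) = g x a + (\<Sum>y\<in>A - {x}. g x y)" if "x \<in> A" for x
  proof -
    have "insert a A - {x} = insert a (A - {x})" using that insert.hyps by auto
    then show ?thesis using insert.hyps by simp
  qed
  have 2: "(\<Sum>y\<in>insert a A - {a}. g a y) = (\<Sum>y\<in>A. - g y a)"
  proof (rule sum.cong)
    show "insert a A - {a} = A" using insert.hyps by auto
    show "g a y = - g y a" if "y \<in> A" for y
      by (rule insert.prems) (use that insert.hyps in auto)
  qed
  have "(\<Sum>x\<in>insert a A. \<Sum>y\<in>insert a A - {x}. g x y) =
      (\<Sum>y\<in>A. - g y a) + (\<Sum>x\<in>A. g x a + (\<Sum>y\<in>A - {x}. g x y))"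
    by (simp only: sum.insert[OF insert.hyps] 2 sum.cong[OF refl[of A] 1])
  also have "(\<Sum>x\<in>A. g x a + (\<Sum>y\<in>A - {x}. g x y)) = (\<Sum>x\<in>A. g x a)"
    using insert.IH[OF insert.prems] by (simp add: sum.distrib)
  also have "(\<Sum>y\<in>A. - g y a) + (\<Sum>x\<in>A. g x a) = 0"
    by (simp add: sum_negf)
  finally show ?case .
qed simp

text \<open>Inserting the smaller of the two indices first raises by one the count behind the sign
  of the other; inserting the larger one first changes nothing. The two orders thus differ by one
  sign.\<close>

lemma ksgn_ksgn_antisymmetric:
  assumes "finite I" "l \<notin> I" "l' \<notin> I" "l \<noteq> l'"
  shows "ksgn l I (ksgn l' (insert l I) a) = - ksgn l' I (ksgn l (insert l' I) a)"
proof -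
  have *: "card {i\<in>insert x I. i < y} = card {i\<in>I. i < y} + (if x < y then 1 else 0)"
    if "x \<notin> I" for x y
  proof (cases "x < y")
    case True
    then have "{i\<in>insert x I. i < y} = insert x {i\<in>I. i < y}" by auto
    then show ?thesis using True that assms(1) by simp
  next
    case False
    then have "{i\<in>insert x I. i < y} = {i\<in>I. i < y}" by auto
    then show ?thesis using False by simp
  qed
  show ?thesis
    unfolding ksgn_def *[OF assms(2)] *[OF assms(3)]
    using assms(4) by (cases l l' rule: linorder_cases) auto
qed

lemma koszul_koszul:
  assumes add: "\<And>l. additive (X l)" and comm: "\<And>l l' v. X l (X l' v) = X l' (X l v)"
  shows "koszul m X (koszul m X w) I = 0"
proof (cases "I \<subseteq> {1..m}")
  case True
  then have fin: "finite I" using finite_subset by blast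
  let ?A = "{1..m} - I"
  let ?g = "\<lambda>l l'. ksgn l I (ksgn l' (insert l I) (X l (X l' (w (insert l' (insert l I))))))"
  have "koszul m X (koszul m X w) I = (\<Sum>l\<in>?A. ksgn l I (X l (koszul m X w (insert l I))))"
    using True by (simp add: koszul_def)
  also have "\<dots> = (\<Sum>l\<in>?A. \<Sum>l'\<in>?A - {l}. ?g l l')"
  proof (rule sum.cong)
    fix l assume l: "l \<in> ?A"
    have "{1..m} - insert l I = ?A - {l}" by auto
    then show "ksgn l I (X l (koszul m X w (insert l I))) = (\<Sum>l'\<in>?A - {l}. ?g l l')"
      using l True
      by (simp add: koszul_def additive.sum[OF add] additive.sum[OF ksgn_additive]
          additive_ksgn[OF add])
  qed simp
  also have "\<dots> = 0"
  proof (rule sum_antisymmetric)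
    fix l l' assume *: "l \<in> ?A" "l' \<in> ?A" "l \<noteq> l'"
    show "?g l l' = - ?g l' l"
      using ksgn_ksgn_antisymmetric[OF fin, of l l'] * by (simp add: insert_commute comm[of l l'])
  qed simp
  finally show ?thesis .
qed (simp add: koszul_def)

text \<open>Wedging from the left with the least index of the result, so that no sign arises. The
  map \<open>sh l\<close> stands for a partial inverse of \<open>X l\<close>.\<close>

definition contraction ::
    "(nat \<Rightarrow> 'a::ab_group_add \<Rightarrow> 'a) \<Rightarrow> (nat set \<Rightarrow> 'a) \<Rightarrow> nat set \<Rightarrow> 'a" where
  "contraction sh w I = (if I = {} then 0 else sh (Min I) (w (I - {Min I})))"

text \<open>In the boundary at \<open>I\<close>, the indices below \<open>Min I\<close> give the sum
  in \<open>split\<close>. The indices above it give, up to sign, terms of the cycle condition at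
  \<open>I - {Min I}\<close> after \<open>sh (Min I)\<close>, and that condition turns them into the
  last summand of \<open>split\<close>. The maps are kept abstract so that polynomial and scalar
  coefficients are both covered; the bound \<open>1 \<le> l'\<close> in \<open>kill\<close> admits
  the scalar case, where \<open>sh 1\<close> is the identity.\<close>

lemma koszul_contraction:
  assumes X: "\<And>l. additive (X l)" and sh: "\<And>l. additive (sh l)"
    and comm: "\<And>l l' v. l < l' \<Longrightarrow> sh l (X l' v) = X l' (sh l v)"
    and kill: "\<And>l l' v. 1 \<le> l' \<Longrightarrow> l' < l \<Longrightarrow> sh l (X l' v) = 0"
    and split: "\<And>I. I \<subseteq> {1..m} \<Longrightarrow> I \<noteq> {} \<Longrightarrow>
      w I = (\<Sum>l\<in>{1..<Min I}. X l (sh l (w I))) + sh (Min I) (X (Min I) (w I))"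
    and split_empty: "w {} = (\<Sum>l\<in>{1..m}. X l (sh l (w {})))"
    and cycle: "\<And>I. koszul m X w I = 0"
    and I: "I \<subseteq> {1..m}"
  shows "koszul m X (contraction sh w) I = w I"
proof (cases "I = {}")
  case True
  have "contraction sh w {l} = sh l (w {})" for l by (simp add: contraction_def)
  then have "koszul m X (contraction sh w) {} = (\<Sum>l\<in>{1..m}. X l (sh l (w {})))"
    by (simp add: koszul_def ksgn_def)
  then show ?thesis unfolding True by (rule trans[OF _ split_empty[symmetric]])
next
  case False
  define \<mu> where "\<mu> = Min I"
  define J where "J = I - {\<mu>}"
  have fin: "finite I" using I finite_subset by blast
  have \<mu>: "\<mu> \<in> I" and \<mu>_le: "\<And>i. i \<in> I \<Longrightarrow> \<mu> \<le> i"
    using False fin by (auto simp: \<mu>_def)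
  then have \<mu>m: "1 \<le> \<mu>" "\<mu> \<le> m" using I by auto
  have IJ: "I = insert \<mu> J" "\<mu> \<notin> J" using \<mu> by (auto simp: J_def)
  have J_gr: "\<mu> < i" if "i \<in> J" for i using \<mu>_le that by (force simp: J_def)
  let ?L = "{1..<\<mu>}" and ?G = "{l\<in>{1..m}. l \<notin> I \<and> \<mu> < l}"
  have parts: "{1..m} - I = ?L \<union> ?G" "{1..m} - J = insert \<mu> (?L \<union> ?G)"
  proof -
    have "{1..m} - I \<subseteq> ?L \<union> ?G"
    proof
      fix l assume l: "l \<in> {1..m} - I"
      then have "l \<noteq> \<mu>" using \<mu> by auto
      then show "l \<in> ?L \<union> ?G" using l by auto
    qed
    moreover have "?L \<subseteq> {1..m} - I" using \<mu>_le \<mu>m by force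
    ultimately show "{1..m} - I = ?L \<union> ?G" by auto
    moreover have "{1..m} - J = insert \<mu> ({1..m} - I)" using \<mu>m IJ by auto
    ultimately show "{1..m} - J = insert \<mu> (?L \<union> ?G)" by metis
  qed
  have disj: "?L \<inter> ?G = {}" and nin: "\<mu> \<notin> ?L \<union> ?G" by auto
  have fin_parts: "finite ?L" "finite ?G" by auto
  note union = sum.union_disjoint[OF fin_parts disj]
  have small: "ksgn l I v = v" if "l \<in> ?L" for l and v :: 'a
    using that \<mu>_le by (intro ksgn_trivial) force
  have smallJ: "ksgn \<mu> J v = v" for v :: 'a
    using J_gr by (intro ksgn_trivial) (simp add: less_imp_le)
  \<comment> \<open>\<open>I\<close> has exactly one element below \<open>l\<close> that
    \<open>J\<close> lacks, namely \<open>\<mu>\<close>.\<close>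
  have large: "ksgn l I v = - ksgn l J v" if "l \<in> ?G" for l and v :: 'a
  proof -
    have "{i\<in>I. i < l} = insert \<mu> {i\<in>J. i < l}" using IJ that by auto
    moreover have "finite {i\<in>J. i < l}" "\<mu> \<notin> {i\<in>J. i < l}" using IJ fin by auto
    ultimately have "card {i\<in>I. i < l} = Suc (card {i\<in>J. i < l})" by simp
    then show ?thesis unfolding ksgn_def by simp
  qed
  have c_small: "contraction sh w (insert l I) = sh l (w I)" if "l \<in> ?L" for l
  proof -
    have "l \<notin> I" using that \<mu>_le by force
    moreover have "Min (insert l I) = l"
      using that fin False by (simp add: \<mu>_def)
    ultimately show ?thesis unfolding contraction_def by simp
  qed
  have c_large: "contraction sh w (insert l I) = sh \<mu> (w (insert l J))" if "l \<in> ?G" for l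
  proof -
    have "Min (insert l I) = \<mu>" using that fin False by (simp add: \<mu>_def)
    moreover have "insert l I - {\<mu>} = insert l J" using that IJ by auto
    ultimately show ?thesis unfolding contraction_def by simp
  qed
  have "koszul m X (contraction sh w) I =
      (\<Sum>l\<in>?L. X l (sh l (w I))) - (\<Sum>l\<in>?G. ksgn l J (X l (sh \<mu> (w (insert l J)))))"
  proof -
    have "koszul m X (contraction sh w) I =
      (\<Sum>l\<in>?L. ksgn l I (X l (contraction sh w (insert l I)))) +
      (\<Sum>l\<in>?G. ksgn l I (X l (contraction sh w (insert l I))))"
      using I unfolding koszul_def parts(1) union by simp
    moreover have "(\<Sum>l\<in>?L. ksgn l I (X l (contraction sh w (insert l I)))) =
        (\<Sum>l\<in>?L. X l (sh l (w I)))"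
      by (rule sum.cong[OF refl]) (simp only: small c_small)
    moreover have "(\<Sum>l\<in>?G. ksgn l I (X l (contraction sh w (insert l I)))) =
        (\<Sum>l\<in>?G. - ksgn l J (X l (sh \<mu> (w (insert l J)))))"
      by (rule sum.cong[OF refl]) (simp only: large c_large)
    ultimately show ?thesis by (simp add: sum_negf)
  qed
  \<comment> \<open>\<open>sh \<mu>\<close> is applied to the cycle condition at \<open>J\<close>:
    the term of \<open>\<mu>\<close> restores \<open>I\<close>, the terms below \<open>\<mu>\<close>
    die by \<open>kill\<close>, and those above are rewritten by \<open>comm\<close>.\<close>
  also have "(\<Sum>l\<in>?G. ksgn l J (X l (sh \<mu> (w (insert l J))))) = - sh \<mu> (X \<mu> (w I))"
  proof -
    have "sh \<mu> (X \<mu> (w I)) + (\<Sum>l\<in>?G. ksgn l J (X l (sh \<mu> (w (insert l J))))) = 0"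
    proof -
      have "J \<subseteq> {1..m}" using I IJ by auto
      then have "0 = (\<Sum>l\<in>insert \<mu> (?L \<union> ?G). ksgn l J (X l (w (insert l J))))"
        using cycle[of J] unfolding koszul_def parts(2) by simp
      also have "\<dots> = X \<mu> (w I) + ((\<Sum>l\<in>?L. ksgn l J (X l (w (insert l J)))) +
          (\<Sum>l\<in>?G. ksgn l J (X l (w (insert l J)))))"
        unfolding sum.insert[OF finite_UnI[OF fin_parts] nin] union smallJ IJ(1)[symmetric] by (rule refl)
      finally have "sh \<mu> 0 = sh \<mu> (X \<mu> (w I) + ((\<Sum>l\<in>?L. ksgn l J (X l (w (insert l J)))) +
          (\<Sum>l\<in>?G. ksgn l J (X l (w (insert l J))))))"
        by (rule arg_cong)
      then have "0 = sh \<mu> (X \<mu> (w I)) + ((\<Sum>l\<in>?L. ksgn l J (sh \<mu> (X l (w (insert l J))))) +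
          (\<Sum>l\<in>?G. ksgn l J (sh \<mu> (X l (w (insert l J))))))"
        by (simp only: additive.zero[OF sh] additive.add[OF sh] additive.sum[OF sh] additive_ksgn[OF sh])
      moreover have "(\<Sum>l\<in>?L. ksgn l J (sh \<mu> (X l (w (insert l J))))) = 0"
        by (rule sum.neutral) (simp add: kill)
      moreover have "(\<Sum>l\<in>?G. ksgn l J (sh \<mu> (X l (w (insert l J))))) =
          (\<Sum>l\<in>?G. ksgn l J (X l (sh \<mu> (w (insert l J)))))"
        by (rule sum.cong) (simp_all add: comm)
      ultimately show ?thesis by (simp only: add_0_left)
    qed
    then show ?thesis
      by (rule eq_neg_iff_add_eq_0[THEN iffD2, OF trans[OF add.commute]])
  qed
  finally show ?thesis
    using split[OF I False] unfolding \<mu>_def[symmetric] diff_minus_eq_add by (rule trans[OF _ sym])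
qed

section \<open>Weighted homogeneous polynomials\<close>

definition lin_ext :: "('a \<Rightarrow> 'b::zero \<Rightarrow> 'c::comm_monoid_add) \<Rightarrow> ('a \<Rightarrow>\<^sub>0 'b) \<Rightarrow> 'c" where
  "lin_ext f p = (\<Sum>t\<in>Poly_Mapping.keys p. f t (Poly_Mapping.lookup p t))"

lemma additive_lin_ext:
  assumes "\<And>t. additive (f t)"
  shows "additive (lin_ext f)"
  by (unfold_locales, unfold lin_ext_def, rule setsum_keys_plus_distrib)
    (simp_all add: additive.zero[OF assms] additive.add[OF assms])

lemma lin_ext_single:
  assumes "f t 0 = 0"
  shows "lin_ext f (Poly_Mapping.single t c) = f t c"
  using assms by (simp add: lin_ext_def)

lemma poly_mapping_sum_singles:
  "p = (\<Sum>t\<in>Poly_Mapping.keys p. Poly_Mapping.single t (Poly_Mapping.lookup p t))"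
proof (rule poly_mapping_eqI)
  fix k
  have "(\<Sum>t\<in>Poly_Mapping.keys p. Poly_Mapping.lookup (Poly_Mapping.single t (Poly_Mapping.lookup p t)) k)
      = (\<Sum>t\<in>Poly_Mapping.keys p. if t = k then Poly_Mapping.lookup p t else 0)"
    by (rule sum.cong) (simp_all add: lookup_single when_def)
  also have "\<dots> = Poly_Mapping.lookup p k"
    by (simp add: in_keys_iff)
  finally show "Poly_Mapping.lookup p k = Poly_Mapping.lookup
      (\<Sum>t\<in>Poly_Mapping.keys p. Poly_Mapping.single t (Poly_Mapping.lookup p t)) k"
    by (simp add: lookup_sum)
qed

text \<open>A polynomial is the sum of its terms. Only exponents occurring in \<open>p\<close> are
  tested, so that hypotheses on \<open>p\<close> such as homogeneity can be used for them.\<close>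

lemma additive_eqI:
  fixes f g :: "('a \<Rightarrow>\<^sub>0 'b::ab_group_add) \<Rightarrow> 'c::ab_group_add"
  assumes f: "additive f" and g: "additive g"
    and "\<And>t c. t \<in> Poly_Mapping.keys p \<Longrightarrow>
      f (Poly_Mapping.single t c) = g (Poly_Mapping.single t c)"
  shows "f p = g p"
proof -
  have "f p = (\<Sum>t\<in>Poly_Mapping.keys p. f (Poly_Mapping.single t (Poly_Mapping.lookup p t)))"
    by (subst poly_mapping_sum_singles) (rule additive.sum[OF f])
  also have "\<dots> = (\<Sum>t\<in>Poly_Mapping.keys p. g (Poly_Mapping.single t (Poly_Mapping.lookup p t)))"
    by (rule sum.cong) (simp_all add: assms(3))
  also have "\<dots> = g p"
    by (subst (2) poly_mapping_sum_singles) (rule additive.sum[OF g, symmetric])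
  finally show ?thesis .
qed

lemma additive_comp:
  assumes "additive f" "additive g"
  shows "additive (\<lambda>x. f (g x))"
  using additive.add[OF assms(1)] additive.add[OF assms(2)] by (simp add: additive_def)

lemma additive_times: "additive (\<lambda>p. q * p :: 'a::ring)"
  by unfold_locales (simp add: distrib_left)

lemma additive_plus:
  assumes "additive f" "additive g"
  shows "additive (\<lambda>x. f x + g x)"
  using additive.add[OF assms(1)] additive.add[OF assms(2)] by (simp add: additive_def add_ac)

lemma additive_sum:
  assumes "\<And>i. i \<in> A \<Longrightarrow> additive (f i)"
  shows "additive (\<lambda>x. \<Sum>i\<in>A. f i x)"
  using additive.add[OF assms] by (simp add: additive_def sum.distrib)

lemma additive_id: "additive (\<lambda>x. x)"
  by unfold_locales simp

section \<open>Weighted degree and division by the least variable\<close>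

lemma keys_add_nat:
  "Poly_Mapping.keys (s + t :: 'a \<Rightarrow>\<^sub>0 nat) = Poly_Mapping.keys s \<union> Poly_Mapping.keys t"
  by (auto simp: in_keys_iff lookup_add)

lemma wdeg_superset:
  assumes "finite A" "Poly_Mapping.keys t \<subseteq> A"
  shows "wdeg d t = (\<Sum>i\<in>A. Poly_Mapping.lookup t i * d i)"
  unfolding wdeg_def using assms by (intro sum.mono_neutral_left) (auto simp: in_keys_iff)

lemma wdeg_add: "wdeg d (s + t) = wdeg d s + wdeg d t"
proof -
  let ?A = "Poly_Mapping.keys s \<union> Poly_Mapping.keys t"
  have "wdeg d (s + t) = (\<Sum>i\<in>?A. Poly_Mapping.lookup (s + t) i * d i)"
    by (rule wdeg_superset) (simp_all add: keys_add_nat)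
  also have "\<dots> = (\<Sum>i\<in>?A. Poly_Mapping.lookup s i * d i) + (\<Sum>i\<in>?A. Poly_Mapping.lookup t i * d i)"
    by (simp add: lookup_add algebra_simps sum.distrib)
  also have "\<dots> = wdeg d s + wdeg d t"
    by (simp add: wdeg_superset[of ?A])
  finally show ?thesis .
qed

lemma wdeg_zero [simp]: "wdeg d 0 = 0"
  by (simp add: wdeg_def)

lemma wdeg_single [simp]: "wdeg d (Poly_Mapping.single l n) = n * d l"
  by (simp add: wdeg_def)

definition mvar :: "nat \<Rightarrow> 'k::field mpolynomial" where
  "mvar l = Poly_Mapping.single (Poly_Mapping.single l 1) 1"

lemma mvar_times_single:
  "mvar l * Poly_Mapping.single t c = Poly_Mapping.single (Poly_Mapping.single l 1 + t) c"
  by (simp add: mvar_def mult_single)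

definition min_var :: "nat \<Rightarrow> (nat \<Rightarrow>\<^sub>0 nat) \<Rightarrow> bool" where
  "min_var l t \<longleftrightarrow> l \<in> Poly_Mapping.keys t \<and> (\<forall>l'\<in>Poly_Mapping.keys t. l \<le> l')"

text \<open>
  The Koszul complex of the polynomial ring is contracted by \<open>X\<^sup>a e_J \<mapsto> (X\<^sup>a / X_l) e_l \<and> e_J\<close>, where
  \<open>l\<close> is the least index that occurs in \<open>X\<^sup>a e_J\<close>.
\<close>

definition var_quot :: "nat \<Rightarrow> 'k::field mpolynomial \<Rightarrow> 'k mpolynomial" where
  "var_quot l = lin_ext (\<lambda>t c. if min_var l t
     then Poly_Mapping.single (t - Poly_Mapping.single l 1) c else 0)"

lemma additive_var_quot: "additive (var_quot l)"
  unfolding var_quot_def by (rule additive_lin_ext) (simp add: additive_def single_add)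

lemma var_quot_single:
  "var_quot l (Poly_Mapping.single t c) =
     (if min_var l t then Poly_Mapping.single (t - Poly_Mapping.single l 1) c else 0)"
  unfolding var_quot_def by (rule lin_ext_single) simp

lemma single_plus_minus_single:
  assumes "l \<in> Poly_Mapping.keys (t :: nat \<Rightarrow>\<^sub>0 nat)"
  shows "Poly_Mapping.single l 1 + (t - Poly_Mapping.single l 1) = t"
  using assms
  by (intro poly_mapping_eqI) (auto simp: lookup_add lookup_minus lookup_single when_def in_keys_iff)

lemma min_var_plus:
  "min_var l (Poly_Mapping.single l' 1 + t) \<longleftrightarrow>
     (if l < l' then min_var l t else l = l' \<and> (\<forall>i\<in>Poly_Mapping.keys t. l \<le> i))"
  by (auto simp: min_var_def keys_add_nat)

text \<open>A factor of larger index neither creates nor destroys the property that \<open>l\<close>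
  is the least index of a monomial. This provides \<open>comm\<close> for the contraction.\<close>

lemma var_quot_mvar_times:
  assumes "l < l'"
  shows "var_quot l (mvar l' * p) = mvar l' * var_quot l p"
proof (rule additive_eqI[of "\<lambda>p. var_quot l (mvar l' * p)" "\<lambda>p. mvar l' * var_quot l p"])
  show "additive (\<lambda>p :: 'a mpolynomial. var_quot l (mvar l' * p))"
    by (rule additive_comp[OF additive_var_quot additive_times])
  show "additive (\<lambda>p :: 'a mpolynomial. mvar l' * var_quot l p)"
    by (rule additive_comp[OF additive_times additive_var_quot])
  fix t and c :: 'a
  have "Poly_Mapping.single l' 1 + t - Poly_Mapping.single l 1 =
      Poly_Mapping.single l' 1 + (t - Poly_Mapping.single l 1)" if "min_var l t"
    using that assms
    by (intro poly_mapping_eqI)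
      (auto simp: lookup_add lookup_minus lookup_single when_def in_keys_iff min_var_def)
  then show "var_quot l (mvar l' * Poly_Mapping.single t c) =
      mvar l' * var_quot l (Poly_Mapping.single t c)"
    using assms min_var_plus[of l l' t]
    by (simp add: mvar_times_single var_quot_single)
qed

text \<open>The least index of a multiple of \<open>X_l'\<close> is at most \<open>l'\<close>, so no
  term is divided by \<open>X_l\<close>. This provides \<open>kill\<close>.\<close>

lemma var_quot_mvar_times_eq_0:
  assumes "l' < l"
  shows "var_quot l (mvar l' * p) = 0"
proof (rule additive_eqI[of "\<lambda>p. var_quot l (mvar l' * p)" "\<lambda>_. 0"])
  show "additive (\<lambda>p :: 'a mpolynomial. var_quot l (mvar l' * p))"
    by (rule additive_comp[OF additive_var_quot additive_times])
  show "additive (\<lambda>_ :: 'a mpolynomial. 0 :: 'a mpolynomial)" by unfold_locales simp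
  show "var_quot l (mvar l' * Poly_Mapping.single t c) = 0" for t and c :: 'a
    using assms min_var_plus[of l l' t]
    by (simp add: mvar_times_single var_quot_single)
qed

lemma mvar_times_var_quot_single:
  "mvar l * var_quot l (Poly_Mapping.single t c) = (if min_var l t then Poly_Mapping.single t c else 0)"
  using single_plus_minus_single[of l t]
  by (simp add: var_quot_single mvar_times_single min_var_def)

lemma sum_min_var:
  fixes v :: "'a::comm_monoid_add"
  assumes "finite A"
  shows "(\<Sum>l\<in>A. if min_var l t then v else 0) =
    (if t \<noteq> 0 \<and> Min (Poly_Mapping.keys t) \<in> A then v else 0)"
proof (cases "t = 0")
  case True
  then show ?thesis by (simp add: min_var_def)
next
  case False
  then have ne: "Poly_Mapping.keys t \<noteq> {}" by simp
  have "min_var l t \<longleftrightarrow> Min (Poly_Mapping.keys t) = l" for l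
    unfolding min_var_def using Min_in[OF _ ne] Min_le by (auto intro: Min_eqI)
  then show ?thesis using False assms by simp
qed

text \<open>A term whose least index is below \<open>i\<close> is restored by exactly one summand of
  the sum. In every other term, the constant included, multiplication by \<open>X_i\<close> makes
  \<open>i\<close> the least index and the quotient takes that factor off again.\<close>

lemma var_quot_split:
  assumes "p \<in> polys m" "i \<in> {1..m}"
  shows "p = (\<Sum>l\<in>{1..<i}. mvar l * var_quot l p) + var_quot i (mvar i * p)"
proof (rule additive_eqI[of "\<lambda>p. p" "\<lambda>p. (\<Sum>l\<in>{1..<i}. mvar l * var_quot l p) + var_quot i (mvar i * p)"])
  show "additive (\<lambda>p :: 'a mpolynomial. (\<Sum>l\<in>{1..<i}. mvar l * var_quot l p) + var_quot i (mvar i * p))"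
    by (intro additive_plus additive_sum additive_comp[OF additive_times additive_var_quot]
        additive_comp[OF additive_var_quot additive_times])
  fix t and c :: 'a assume t: "t \<in> Poly_Mapping.keys p"
  then have keys: "Poly_Mapping.keys t \<subseteq> {1..m}" using assms by (auto simp: polys_def)
  have "var_quot i (mvar i * Poly_Mapping.single t c) =
      (if \<forall>j\<in>Poly_Mapping.keys t. i \<le> j then Poly_Mapping.single t c else 0)"
    using min_var_plus[of i i t] by (simp add: mvar_times_single var_quot_single)
  moreover have "(\<forall>j\<in>Poly_Mapping.keys t. i \<le> j) \<longleftrightarrow>
      \<not> (t \<noteq> 0 \<and> Min (Poly_Mapping.keys t) \<in> {1..<i})"
  proof (cases "t = 0")
    case False
    then have ne: "Poly_Mapping.keys t \<noteq> {}" by simp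
    then have "Min (Poly_Mapping.keys t) < i \<longleftrightarrow> (\<exists>j\<in>Poly_Mapping.keys t. j < i)"
      by (intro Min_less_iff) simp_all
    moreover have "Min (Poly_Mapping.keys t) \<in> {1..m}" using Min_in[OF finite_keys ne] keys by blast
    ultimately show ?thesis using False by (auto simp: not_less)
  qed simp
  ultimately show "Poly_Mapping.single t c =
      (\<Sum>l\<in>{1..<i}. mvar l * var_quot l (Poly_Mapping.single t c)) +
      var_quot i (mvar i * Poly_Mapping.single t c)"
    by (simp only: mvar_times_var_quot_single sum_min_var finite_atLeastLessThan) simp
qed (rule additive_id)

text \<open>Every nonconstant term is restored by the summand of its least index. A constant term
  has no such index, hence the second assumption.\<close>

lemma var_quot_split_augmentation:
  assumes "p \<in> polys m" "Poly_Mapping.lookup p 0 = 0"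
  shows "p = (\<Sum>l\<in>{1..m}. mvar l * var_quot l p)"
proof (rule additive_eqI[of "\<lambda>p. p" "\<lambda>p. (\<Sum>l\<in>{1..m}. mvar l * var_quot l p)"])
  show "additive (\<lambda>p :: 'a mpolynomial. (\<Sum>l\<in>{1..m}. mvar l * var_quot l p))"
    by (intro additive_sum additive_comp[OF additive_times additive_var_quot])
  fix t and c :: 'a assume t: "t \<in> Poly_Mapping.keys p"
  then have keys: "Poly_Mapping.keys t \<subseteq> {1..m}" using assms by (auto simp: polys_def)
  from t assms have "t \<noteq> 0" by (auto simp: in_keys_iff)
  then have ne: "Poly_Mapping.keys t \<noteq> {}" by simp
  then have "Min (Poly_Mapping.keys t) \<in> {1..m}" using Min_in[OF finite_keys ne] keys by blast
  then show "Poly_Mapping.single t c = (\<Sum>l\<in>{1..m}. mvar l * var_quot l (Poly_Mapping.single t c))"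
    using \<open>t \<noteq> 0\<close> by (simp only: mvar_times_var_quot_single sum_min_var finite_atLeastAtMost) simp
qed (rule additive_id)

lemma keys_var_quot:
  assumes "s \<in> Poly_Mapping.keys (var_quot l p)"
  shows "Poly_Mapping.single l 1 + s \<in> Poly_Mapping.keys p"
proof -
  have "Poly_Mapping.lookup (var_quot l p) s \<noteq> 0" using assms by (simp add: in_keys_iff)
  then obtain t where t: "t \<in> Poly_Mapping.keys p"
    "Poly_Mapping.lookup (if min_var l t then Poly_Mapping.single (t - Poly_Mapping.single l 1)
       (Poly_Mapping.lookup p t) else 0) s \<noteq> 0"
    unfolding var_quot_def lin_ext_def lookup_sum by (rule sum.not_neutral_contains_not_neutral)
  then have "min_var l t" "s = t - Poly_Mapping.single l 1"
    by (auto simp: lookup_single when_def split: if_splits)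
  then show ?thesis using single_plus_minus_single[of l t] t by (simp add: min_var_def)
qed

lemma lookup_times_zero:
  fixes p q :: "'k::field mpolynomial"
  assumes "Poly_Mapping.lookup p 0 = 0"
  shows "Poly_Mapping.lookup (p * q) 0 = 0"
proof -
  have "0 \<notin> Poly_Mapping.keys (p * q)"
  proof
    assume "0 \<in> Poly_Mapping.keys (p * q)"
    then obtain s t where st: "0 = s + t" "s \<in> Poly_Mapping.keys p"
      using keys_mult[of p q] by auto
    then have "Poly_Mapping.keys s \<union> Poly_Mapping.keys t = {}"
      by (metis keys_add_nat keys_zero)
    then have "s = 0" by simp
    with st assms show False by (simp add: in_keys_iff)
  qed
  then show ?thesis by (simp add: in_keys_iff)
qed

lemma lookup_mvar_zero [simp]: "Poly_Mapping.lookup (mvar l) 0 = 0"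
proof -
  have "Poly_Mapping.keys (Poly_Mapping.single l (1::nat)) \<noteq> Poly_Mapping.keys 0" by simp
  then have "Poly_Mapping.single l (1::nat) \<noteq> 0" by metis
  then show ?thesis by (simp add: mvar_def lookup_single)
qed

section \<open>Polynomials in the given variables and their homogeneous parts\<close>

lemma zero_in_polys [simp]: "0 \<in> polys m"
  by (simp add: polys_def)

lemma add_in_polys: "p \<in> polys m \<Longrightarrow> q \<in> polys m \<Longrightarrow> p + q \<in> polys m"
  unfolding polys_def using keys_add[of p q] by blast

lemma uminus_in_polys: "p \<in> polys m \<Longrightarrow> - p \<in> polys m"
  by (simp add: polys_def in_keys_iff)

lemma mult_in_polys: "p \<in> polys m \<Longrightarrow> q \<in> polys m \<Longrightarrow> p * q \<in> polys m"
  unfolding polys_def using keys_mult[of p q] by (fastforce simp: keys_add_nat)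

lemma mvar_in_polys: "l \<in> {1..m} \<Longrightarrow> mvar l \<in> polys m"
  by (simp add: polys_def mvar_def)

lemma var_quot_in_polys: "p \<in> polys m \<Longrightarrow> var_quot l p \<in> polys m"
  unfolding polys_def using keys_var_quot[of _ l p] by (fastforce simp: keys_add_nat)

text \<open>The degree is an integer so that differences of degrees need no truncation; for negative
  \<open>y\<close> only the zero polynomial qualifies.\<close>

definition homog :: "(nat \<Rightarrow> nat) \<Rightarrow> int \<Rightarrow> 'k::field mpolynomial \<Rightarrow> bool" where
  "homog d y p \<longleftrightarrow> (\<forall>t\<in>Poly_Mapping.keys p. int (wdeg d t) = y)"

lemma homog_zero [simp]: "homog d y 0"
  by (simp add: homog_def)

lemma homog_add: "homog d y p \<Longrightarrow> homog d y q \<Longrightarrow> homog d y (p + q)"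
  unfolding homog_def using keys_add[of p q] by blast

lemma homog_uminus: "homog d y p \<Longrightarrow> homog d y (- p)"
  by (simp add: homog_def in_keys_iff)

lemma homog_mult: "homog d y p \<Longrightarrow> homog d z q \<Longrightarrow> homog d (y + z) (p * q)"
  unfolding homog_def using keys_mult[of p q] by (fastforce simp: wdeg_add)

lemma homog_mvar: "homog d (int (d l)) (mvar l)"
  by (simp add: homog_def mvar_def)

lemma homog_var_quot: "homog d y p \<Longrightarrow> homog d (y - int (d l)) (var_quot l p)"
  unfolding homog_def using keys_var_quot[of _ l p] by (fastforce simp: wdeg_add)

definition homog_part :: "(nat \<Rightarrow> nat) \<Rightarrow> int \<Rightarrow> 'k::field mpolynomial \<Rightarrow> 'k mpolynomial" where
  "homog_part d y = lin_ext (\<lambda>t c. if int (wdeg d t) = y then Poly_Mapping.single t c else 0)"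

lemma additive_homog_part: "additive (homog_part d y)"
  unfolding homog_part_def by (rule additive_lin_ext) (simp add: additive_def single_add)

lemma homog_part_single:
  "homog_part d y (Poly_Mapping.single t c) =
     (if int (wdeg d t) = y then Poly_Mapping.single t c else 0)"
  unfolding homog_part_def by (rule lin_ext_single) simp

lemma homog_part_eq: "homog d y p \<Longrightarrow> homog_part d y p = p"
  by (rule additive_eqI[of "homog_part d y" "\<lambda>p. p", OF additive_homog_part additive_id]) (simp add: homog_part_single homog_def)

lemma keys_homog_part:
  assumes "s \<in> Poly_Mapping.keys (homog_part d y p)"
  shows "s \<in> Poly_Mapping.keys p" "int (wdeg d s) = y"
proof -
  have "Poly_Mapping.lookup (homog_part d y p) s \<noteq> 0" using assms by (simp add: in_keys_iff)
  then obtain t where t: "t \<in> Poly_Mapping.keys p"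
    "Poly_Mapping.lookup (if int (wdeg d t) = y then Poly_Mapping.single t
       (Poly_Mapping.lookup p t) else 0) s \<noteq> 0"
    unfolding homog_part_def lin_ext_def lookup_sum by (rule sum.not_neutral_contains_not_neutral)
  then show "s \<in> Poly_Mapping.keys p" "int (wdeg d s) = y"
    by (auto simp: lookup_single when_def split: if_splits)
qed

lemma homog_homog_part: "homog d y (homog_part d y p)"
  using keys_homog_part by (auto simp: homog_def)

lemma homog_part_in_polys: "p \<in> polys m \<Longrightarrow> homog_part d y p \<in> polys m"
  using keys_homog_part by (fastforce simp: polys_def)

text \<open>Both sides are additive in \<open>p\<close> and in \<open>q\<close>, which reduces the
  claim to a product of two single terms, the second of which is kept or dropped by its
  degree.\<close>

lemma homog_part_times:
  assumes "homog d z q"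
  shows "homog_part d (z + y) (q * p) = q * homog_part d y p"
proof (rule additive_eqI[of "\<lambda>p. homog_part d (z + y) (q * p)" "\<lambda>p. q * homog_part d y p"])
  show "additive (\<lambda>p :: 'a mpolynomial. homog_part d (z + y) (q * p))"
    by (rule additive_comp[OF additive_homog_part additive_times])
  show "additive (\<lambda>p :: 'a mpolynomial. q * homog_part d y p)"
    by (rule additive_comp[OF additive_times additive_homog_part])
  fix t and c :: 'a
  let ?s = "Poly_Mapping.single t c :: 'a mpolynomial"
  show "homog_part d (z + y) (q * ?s) = q * homog_part d y ?s"
  proof (rule additive_eqI[of "\<lambda>q. homog_part d (z + y) (q * ?s)" "\<lambda>q. q * homog_part d y ?s"])
    show "additive (\<lambda>q :: 'a mpolynomial. homog_part d (z + y) (q * ?s))"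
      by (rule additive_comp[OF additive_homog_part]) (simp add: additive_def distrib_right)
    show "additive (\<lambda>q :: 'a mpolynomial. q * homog_part d y ?s)"
      by (simp add: additive_def distrib_right)
    fix t' and c' :: 'a assume "t' \<in> Poly_Mapping.keys q"
    then have "int (wdeg d t') = z" using assms by (simp add: homog_def)
    then show "homog_part d (z + y) (Poly_Mapping.single t' c' * ?s) =
        Poly_Mapping.single t' c' * homog_part d y ?s"
      by (simp add: mult_single homog_part_single wdeg_add)
  qed
qed

text \<open>Substitution of 1 for all variables. On polynomials of degree \<open>y\<close> it is the
  coefficient of \<open>z^y\<close> in the image under \<open>monomial_map\<close>, so each graded
  piece of the semigroup ring can be treated as a subspace of \<open>k\<close>.\<close>

definition eval_ones :: "'k::field mpolynomial \<Rightarrow> 'k" where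
  "eval_ones = lin_ext (\<lambda>t c. c)"

lemma additive_eval_ones: "additive eval_ones"
  unfolding eval_ones_def by (rule additive_lin_ext) (simp add: additive_def)

lemma eval_ones_single [simp]: "eval_ones (Poly_Mapping.single t c) = c"
  unfolding eval_ones_def by (rule lin_ext_single) simp

lemma eval_ones_mvar_times: "eval_ones (mvar l * p) = eval_ones p"
  by (rule additive_eqI[of "\<lambda>p. eval_ones (mvar l * p)" eval_ones,
        OF additive_comp[OF additive_eval_ones additive_times] additive_eval_ones])
    (simp add: mvar_times_single)

lemma monomial_map_homog:
  assumes "homog d y p"
  shows "monomial_map d p = monom (eval_ones p) (nat y)"
proof -
  have "monomial_map d p = (\<Sum>t\<in>Poly_Mapping.keys p. monom (Poly_Mapping.lookup p t) (nat y))"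
    unfolding monomial_map_def
  proof (rule sum.cong)
    fix t assume "t \<in> Poly_Mapping.keys p"
    then have "wdeg d t = nat y" using assms by (auto simp: homog_def)
    then show "monom (Poly_Mapping.lookup p t) (wdeg d t) = monom (Poly_Mapping.lookup p t) (nat y)"
      by simp
  qed simp
  also have "\<dots> = monom (eval_ones p) (nat y)"
    by (simp add: eval_ones_def lin_ext_def monom_sum)
  finally show ?thesis .
qed

lemma wdeg_in_semigroup:
  assumes "Poly_Mapping.keys t \<subseteq> {1..m}"
  shows "int (wdeg d t) \<in> semigroup_of m d"
  unfolding semigroup_of_def wdeg_superset[OF _ assms, simplified] by auto

lemma semigroup_monomial:
  assumes "y \<in> semigroup_of m d"
  obtains t where "Poly_Mapping.keys t \<subseteq> {1..m}" "int (wdeg d t) = y"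
proof -
  from assms obtain x :: "nat \<Rightarrow> nat" where y: "y = (\<Sum>i=1..m. int (x i * d i))"
    by (auto simp: semigroup_of_def)
  define t where "t = (\<Sum>i\<in>{1..m}. Poly_Mapping.single i (x i))"
  have "Poly_Mapping.lookup t k = (if k \<in> {1..m} then x k else 0)" for k
  proof -
    have "Poly_Mapping.lookup t k = (\<Sum>i\<in>{1..m}. if i = k then x k else 0)"
      unfolding t_def lookup_sum by (rule sum.cong) (auto simp: lookup_single when_def)
    then show ?thesis by simp
  qed
  note lk = this
  have keys: "Poly_Mapping.keys t \<subseteq> {1..m}" by (auto simp: in_keys_iff lk split: if_splits)
  have "int (wdeg d t) = y"
    unfolding wdeg_superset[OF finite_atLeastAtMost keys] y by (simp add: lk)
  with keys show thesis by (rule that)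
qed

section \<open>Koszul homology of a minimal graded resolution\<close>

lemma sum_fun_apply: "(\<Sum>i\<in>A. f i) x = (\<Sum>i\<in>A. f i x :: 'a::comm_monoid_add)"
  by (induction A rule: infinite_finite_induct) simp_all

definition add_closed :: "'a::ab_group_add set \<Rightarrow> bool" where
  "add_closed A \<longleftrightarrow> 0 \<in> A \<and> (\<forall>x\<in>A. \<forall>y\<in>A. x + y \<in> A) \<and> (\<forall>x\<in>A. - x \<in> A)"

lemma add_closed_sum:
  "add_closed A \<Longrightarrow> (\<And>i. i \<in> J \<Longrightarrow> f i \<in> A) \<Longrightarrow> sum f J \<in> A"
  by (induction J rule: infinite_finite_induct) (simp_all add: add_closed_def)

lemma add_closed_diff: "add_closed A \<Longrightarrow> x \<in> A \<Longrightarrow> y \<in> A \<Longrightarrow> x - y \<in> A"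
  unfolding add_closed_def diff_conv_add_uminus by blast

lemma add_closed_ksgn: "add_closed A \<Longrightarrow> x \<in> A \<Longrightarrow> ksgn l I x \<in> A"
  by (simp add: add_closed_def ksgn_def)

text \<open>The coefficient group may depend on \<open>I\<close>, which records the degree of
  \<open>e_I\<close>. Values at all other \<open>I\<close> are forced to be 0, so that equality of
  forms is equality of functions.\<close>

definition forms :: "nat \<Rightarrow> (nat set \<Rightarrow> 'a::zero set) \<Rightarrow> nat \<Rightarrow> (nat set \<Rightarrow> 'a) set" where
  "forms m A p = {w. \<forall>I. if I \<subseteq> {1..m} \<and> card I = p then w I \<in> A I else w I = 0}"

lemma formsI:
  assumes "\<And>I. I \<subseteq> {1..m} \<Longrightarrow> card I = p \<Longrightarrow> w I \<in> A I"
    and "\<And>I. \<not> (I \<subseteq> {1..m} \<and> card I = p) \<Longrightarrow> w I = 0"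
  shows "w \<in> forms m A p"
  using assms by (simp add: forms_def)

lemma forms_mem:
  assumes "w \<in> forms m A p"
  shows "I \<subseteq> {1..m} \<Longrightarrow> card I = p \<Longrightarrow> w I \<in> A I"
    and "\<not> (I \<subseteq> {1..m} \<and> card I = p) \<Longrightarrow> w I = 0"
  using assms unfolding forms_def by (auto split: if_splits)

lemma forms_mem_add_closed:
  assumes "w \<in> forms m A p" "add_closed (A I)"
  shows "w I \<in> A I"
  using forms_mem[OF assms(1), of I] assms(2) unfolding add_closed_def by metis

lemma forms_diff:
  assumes "v \<in> forms m A p" "w \<in> forms m A p" "\<And>I. add_closed (A I)"
  shows "(\<lambda>I. v I - w I) \<in> forms m A p"
  using forms_mem[OF assms(1)] forms_mem[OF assms(2)] assms(3)
  by (intro formsI) (simp_all add: add_closed_diff)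

lemma koszul_cong:
  assumes "\<And>I. I \<subseteq> {1..m} \<Longrightarrow> v I = w I"
  shows "koszul m X v I = koszul m X w I"
  using assms by (auto simp: koszul_def intro!: sum.cong)

lemma koszul_in_forms:
  assumes w: "w \<in> forms m A (Suc p)" and B: "\<And>I. add_closed (B I)" and X: "\<And>l. additive (X l)"
    and XAB: "\<And>I l v. I \<subseteq> {1..m} \<Longrightarrow> l \<in> {1..m} - I \<Longrightarrow> v \<in> A (insert l I) \<Longrightarrow> X l v \<in> B I"
  shows "koszul m X w \<in> forms m B p"
proof (rule formsI)
  have card: "card (insert l I) = Suc (card I)" if "I \<subseteq> {1..m}" "l \<notin> I" for l I
    using that finite_subset by (metis card_insert_disjoint finite_atLeastAtMost)
  show "koszul m X w I \<in> B I" if "I \<subseteq> {1..m}" "card I = p" for I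
  proof -
    have "X l (w (insert l I)) \<in> B I" if "l \<in> {1..m} - I" for l
      using XAB forms_mem(1)[OF w, of "insert l I"] \<open>I \<subseteq> {1..m}\<close> \<open>card I = p\<close> that card by auto
    then show ?thesis
      using B that by (auto simp: koszul_def intro!: add_closed_sum add_closed_ksgn)
  qed
  show "koszul m X w I = 0" if *: "\<not> (I \<subseteq> {1..m} \<and> card I = p)" for I
  proof (cases "I \<subseteq> {1..m}")
    case True
    have "w (insert l I) = 0" if "l \<in> {1..m} - I" for l
      using forms_mem(2)[OF w, of "insert l I"] * True that card by auto
    then show ?thesis by (simp add: koszul_def additive.zero[OF X])
  qed (simp add: koszul_def)
qed

text \<open>The contraction itself need not vanish at sets outside \<open>{1..m}\<close>, for
  instance at \<open>{m + 1}\<close>; the guard makes it a form.\<close>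

lemma forms_contraction:
  assumes w: "w \<in> forms m A p" and sh: "\<And>l. additive (sh l)"
    and AB: "\<And>I. I \<subseteq> {1..m} \<Longrightarrow> card I = Suc p \<Longrightarrow> w (I - {Min I}) \<in> A (I - {Min I}) \<Longrightarrow>
      Min I \<in> I \<Longrightarrow> sh (Min I) (w (I - {Min I})) \<in> B I"
  shows "(\<lambda>I. if I \<subseteq> {1..m} then contraction sh w I else 0) \<in> forms m B (Suc p)"
proof (rule formsI)
  have *: "finite I" if "I \<subseteq> {1..m}" for I using that finite_subset by blast
  show "(if I \<subseteq> {1..m} then contraction sh w I else 0) \<in> B I"
    if I: "I \<subseteq> {1..m}" "card I = Suc p" for I
  proof -
    have "I \<noteq> {}" using I by auto
    then have "Min I \<in> I" using *[OF I(1)] by simp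
    then have "card (I - {Min I}) = p" using I *[OF I(1)] by simp
    moreover have "I - {Min I} \<subseteq> {1..m}" using I by blast
    ultimately have "w (I - {Min I}) \<in> A (I - {Min I})" using forms_mem(1)[OF w] by blast
    then show ?thesis using AB[OF I] I \<open>I \<noteq> {}\<close> \<open>Min I \<in> I\<close> by (simp add: contraction_def)
  qed
  show "(if I \<subseteq> {1..m} then contraction sh w I else 0) = 0"
    if I: "\<not> (I \<subseteq> {1..m} \<and> card I = Suc p)" for I
  proof (cases "I \<subseteq> {1..m} \<and> I \<noteq> {}")
    case True
    then have "Min I \<in> I" "finite I" using *[of I] by auto
    then have "card (I - {Min I}) \<noteq> p"
      using I True by (metis card_Suc_Diff1)
    then have "w (I - {Min I}) = 0" using forms_mem(2)[OF w] by blast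
    then show ?thesis by (simp add: contraction_def additive.zero[OF sh])
  qed (auto simp: contraction_def)
qed

definition degs :: "(nat \<Rightarrow> nat) \<Rightarrow> nat set \<Rightarrow> int" where
  "degs d I = int (\<Sum>j\<in>I. d j)"

lemma degs_insert: "finite I \<Longrightarrow> l \<notin> I \<Longrightarrow> degs d (insert l I) = int (d l) + degs d I"
  by (simp add: degs_def)

lemma degs_remove: "finite I \<Longrightarrow> l \<in> I \<Longrightarrow> degs d I = int (d l) + degs d (I - {l})"
  by (simp add: degs_def sum.remove)

definition smul :: "nat \<Rightarrow> (nat \<Rightarrow> 'k::field mpolynomial) \<Rightarrow> nat \<Rightarrow> 'k mpolynomial" where
  "smul l v = (\<lambda>j. mvar l * v j)"

definition squot :: "nat \<Rightarrow> (nat \<Rightarrow> 'k::field mpolynomial) \<Rightarrow> nat \<Rightarrow> 'k mpolynomial" where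
  "squot l v = (\<lambda>j. var_quot l (v j))"

definition aug :: "(nat \<Rightarrow> 'k::field mpolynomial) \<Rightarrow> 'k" where
  "aug v = eval_ones (v 1)"

lemma additive_smul: "additive (smul l)"
  by (simp add: additive_def smul_def fun_eq_iff distrib_left)

lemma additive_squot: "additive (squot l)"
  by (simp add: additive_def squot_def fun_eq_iff additive.add[OF additive_var_quot])

lemma additive_aug: "additive aug"
  by (simp add: additive_def aug_def additive.add[OF additive_eval_ones])

lemma aug_smul: "aug (smul l v) = aug v"
  by (simp add: aug_def smul_def eval_ones_mvar_times)

lemma smul_commute: "smul l (smul l' v) = smul l' (smul l v)"
  by (simp add: smul_def fun_eq_iff mult.left_commute)

text \<open>With scalar coefficients on all subsets this is the chain complex of a full simplex, a
  cone with apex 1; the contraction is the wedge with \<open>e_1\<close>.\<close>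

lemma koszul_scalar_contraction:
  assumes "1 \<le> m" "\<And>I. koszul m (\<lambda>l a. a) w I = 0" "I \<subseteq> {1..m}"
  shows "koszul m (\<lambda>l a. a) (contraction (\<lambda>l a. if l = 1 then a else 0) w) I =
    (w I :: 'a::ab_group_add)"
proof (rule koszul_contraction)
  show "additive (\<lambda>a :: 'a. a)" by (rule additive_id)
  show "additive (\<lambda>a :: 'a. if l = 1 then a else 0)" for l :: nat
    by unfold_locales simp
  show "w I = (\<Sum>l = 1..<Min I. if l = 1 then w I else 0) + (if Min I = 1 then w I else 0)"
    if "I \<subseteq> {1..m}" "I \<noteq> {}" for I
  proof -
    have "Min I \<in> I" using that finite_subset by (intro Min_in) auto
    then have "1 \<le> Min I" using that by auto
    then show ?thesis by (cases "Min I = 1") simp_all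
  qed
  show "w {} = (\<Sum>l = 1..m. if l = 1 then w {} else 0)" using assms(1) by simp
qed (use assms in auto)

lemma sum_in_polys: "(\<And>i. i \<in> A \<Longrightarrow> f i \<in> polys m) \<Longrightarrow> sum f A \<in> polys m"
  by (rule add_closed_sum) (auto simp: add_closed_def add_in_polys uminus_in_polys)

lemma homog_sum: "(\<And>i. i \<in> A \<Longrightarrow> homog d y (f i)) \<Longrightarrow> homog d y (sum f A)"
  using add_closed_sum[of "{p. homog d y p}" A f]
  by (auto simp: add_closed_def homog_add homog_uminus)

section \<open>The graded pieces of the resolution\<close>

locale graded_resolution =
  fixes m :: nat and d b :: "nat \<Rightarrow> nat" and c :: "nat \<Rightarrow> nat \<Rightarrow> nat"
    and D :: "nat \<Rightarrow> nat \<Rightarrow> nat \<Rightarrow> 'k::field mpolynomial"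
  assumes resolution: "minimal_graded_free_resolution m d b c D"
begin

definition bd :: "nat \<Rightarrow> (nat \<Rightarrow> 'k mpolynomial) \<Rightarrow> nat \<Rightarrow> 'k mpolynomial" where
  "bd k = mat_apply (b k) (b (Suc k)) (D k)"

text \<open>The part of degree \<open>y\<close> of \<open>F_k\<close>, where the basis element
  \<open>j\<close> contributes its own degree \<open>c j k\<close>.\<close>

definition piece :: "nat \<Rightarrow> int \<Rightarrow> (nat \<Rightarrow> 'k mpolynomial) set" where
  "piece k y = {v \<in> free_module m (b k). \<forall>j\<in>{1..b k}. homog d (y - int (c j k)) (v j)}"

lemma matrix_entry:
  assumes "r \<in> {1..b k}" "j \<in> {1..b (Suc k)}"
  shows "D k r j \<in> polys m" "homog d (int (c j (Suc k)) - int (c r k)) (D k r j)"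
    "Poly_Mapping.lookup (D k r j) 0 = 0"
proof -
  from resolution assms have *: "D k r j \<in> polys m \<and>
      (\<forall>t\<in>Poly_Mapping.keys (D k r j). wdeg d t + c r k = c j (Suc k)) \<and>
      Poly_Mapping.lookup (D k r j) 0 = 0"
    unfolding minimal_graded_free_resolution_def by blast
  then show "D k r j \<in> polys m" "Poly_Mapping.lookup (D k r j) 0 = 0" by auto
  show "homog d (int (c j (Suc k)) - int (c r k)) (D k r j)"
    unfolding homog_def using * by force
qed

lemma additive_bd: "additive (bd k)"
  by (simp add: additive_def bd_def mat_apply_def fun_eq_iff distrib_left sum.distrib)

lemma bd_smul: "bd k (smul l v) = smul l (bd k v)"
  by (simp add: bd_def mat_apply_def smul_def fun_eq_iff sum_distrib_left mult.left_commute)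

lemma lookup_bd_zero: "Poly_Mapping.lookup (bd k v r) 0 = 0"
  by (auto simp: bd_def mat_apply_def lookup_sum lookup_times_zero matrix_entry(3))

lemma piece_component: "v \<in> piece k y \<Longrightarrow> v j \<in> polys m"
  by (cases "j \<in> {1..b k}") (auto simp: piece_def free_module_def)

lemma add_closed_piece: "add_closed (piece k y)"
  by (auto simp: add_closed_def piece_def free_module_def
      intro: add_in_polys uminus_in_polys homog_add homog_uminus)

lemma bd_in_piece:
  assumes "v \<in> piece (Suc k) y"
  shows "bd k v \<in> piece k y"
proof -
  have "D k r j * v j \<in> polys m" "homog d (y - int (c r k)) (D k r j * v j)"
    if "r \<in> {1..b k}" "j \<in> {1..b (Suc k)}" for r j
  proof -
    show "D k r j * v j \<in> polys m"
      using matrix_entry(1)[OF that] piece_component[OF assms] by (rule mult_in_polys)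
    have "homog d (y - int (c j (Suc k))) (v j)" using assms that by (simp add: piece_def)
    from homog_mult[OF matrix_entry(2)[OF that] this]
    show "homog d (y - int (c r k)) (D k r j * v j)" by simp
  qed
  then show ?thesis
    by (auto simp: piece_def free_module_def bd_def mat_apply_def intro!: sum_in_polys homog_sum)
qed

lemma smul_in_piece:
  assumes "v \<in> piece k y" "l \<in> {1..m}"
  shows "smul l v \<in> piece k (y + int (d l))"
proof -
  have "homog d (y + int (d l) - int (c j k)) (mvar l * v j)" if "j \<in> {1..b k}" for j
  proof -
    have "homog d (y - int (c j k)) (v j)" using assms(1) that by (simp add: piece_def)
    from homog_mult[OF homog_mvar[of d l] this] show ?thesis by (simp add: algebra_simps)
  qed
  then show ?thesis
    using assms by (auto simp: piece_def free_module_def smul_def mult_in_polys mvar_in_polys)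
qed

lemma squot_in_piece:
  assumes "v \<in> piece k y"
  shows "squot l v \<in> piece k (y - int (d l))"
proof -
  have "homog d (y - int (d l) - int (c j k)) (var_quot l (v j))" if "j \<in> {1..b k}" for j
  proof -
    have "homog d (y - int (c j k)) (v j)" using assms(1) that by (simp add: piece_def)
    from homog_var_quot[OF this, of l] show ?thesis by (simp add: algebra_simps)
  qed
  then show ?thesis
    using assms by (auto simp: piece_def free_module_def squot_def var_quot_in_polys
        additive.zero[OF additive_var_quot])
qed

text \<open>The differential has degree zero, so it commutes with passing to homogeneous parts; the
  parts of the right degrees in \<open>u\<close> already map to \<open>bd k u\<close>. This turns
  exactness of the resolution into exactness in each degree.\<close>

lemma piece_project:
  assumes "u \<in> free_module m (b (Suc k))" "bd k u \<in> piece k y"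
  shows "\<exists>u'\<in>piece (Suc k) y. bd k u' = bd k u"
proof
  let ?u = "\<lambda>j. homog_part d (y - int (c j (Suc k))) (u j)"
  show "?u \<in> piece (Suc k) y"
    using assms(1) by (auto simp: piece_def free_module_def homog_homog_part homog_part_in_polys
        additive.zero[OF additive_homog_part])
  show "bd k ?u = bd k u"
  proof
    fix r
    show "bd k ?u r = bd k u r"
    proof (cases "r \<in> {1..b k}")
      case True
      have "D k r j * ?u j = homog_part d (y - int (c r k)) (D k r j * u j)"
        if "j \<in> {1..b (Suc k)}" for j
        using homog_part_times[OF matrix_entry(2)[OF True that], of "y - int (c j (Suc k))" "u j"]
        by simp
      then have "bd k ?u r = (\<Sum>j=1..b (Suc k). homog_part d (y - int (c r k)) (D k r j * u j))"
        using True by (simp add: bd_def mat_apply_def)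
      also have "\<dots> = homog_part d (y - int (c r k)) (bd k u r)"
        using True by (simp add: bd_def mat_apply_def additive.sum[OF additive_homog_part])
      also have "\<dots> = bd k u r"
        using assms(2) True by (simp add: piece_def homog_part_eq)
      finally show ?thesis .
    next
      case False
      then show ?thesis unfolding bd_def mat_apply_def by (simp only: if_False)
    qed
  qed
qed

lemma bd_exact:
  assumes "v \<in> piece (Suc k) y" "bd k v = 0"
  shows "\<exists>u\<in>piece (Suc (Suc k)) y. bd (Suc k) u = v"
proof -
  have "bd (Suc k) ` free_module m (b (Suc (Suc k))) = {v \<in> free_module m (b (Suc k)). bd k v = (\<lambda>_. 0)}"
    using resolution unfolding minimal_graded_free_resolution_def bd_def by blast
  moreover have "v \<in> {v \<in> free_module m (b (Suc k)). bd k v = (\<lambda>_. 0)}"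
    using assms by (simp add: piece_def zero_fun_def)
  ultimately have "v \<in> bd (Suc k) ` free_module m (b (Suc (Suc k)))" by (simp only:)
  then obtain u where "v = bd (Suc k) u" "u \<in> free_module m (b (Suc (Suc k)))" by (rule imageE)
  then show ?thesis using piece_project[of u "Suc k" y] assms(1) by (simp only:)
qed

lemma degree_zero_module: "b 0 = 1" "c 1 0 = 0"
  using resolution unfolding minimal_graded_free_resolution_def by auto

lemma aug_exact:
  assumes "v \<in> piece 0 y"
  shows "aug v = 0 \<longleftrightarrow> (\<exists>u\<in>piece 1 y. bd 0 u = v)"
proof -
  have im: "bd 0 ` free_module m (b 1) = {v \<in> free_module m (b 0). monomial_map d (v 1) = 0}"
    using resolution unfolding minimal_graded_free_resolution_def bd_def One_nat_def
    by blast
  have "homog d y (v 1)" using assms degree_zero_module by (simp add: piece_def)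
  from monomial_map_homog[OF this] have "aug v = 0 \<longleftrightarrow> monomial_map d (v 1) = 0"
    by (simp add: aug_def)
  also have "\<dots> \<longleftrightarrow> v \<in> bd 0 ` free_module m (b 1)"
    using assms unfolding im by (simp add: piece_def)
  also have "\<dots> \<longleftrightarrow> (\<exists>u\<in>piece 1 y. bd 0 u = v)"
  proof
    assume "v \<in> bd 0 ` free_module m (b 1)"
    then obtain u where "v = bd 0 u" "u \<in> free_module m (b 1)" by (rule imageE)
    then show "\<exists>u\<in>piece 1 y. bd 0 u = v"
      using piece_project[of u 0 y] assms by (simp only: One_nat_def)
  qed (auto simp: piece_def)
  finally show ?thesis .
qed

lemma bd_bd:
  assumes "v \<in> piece (Suc (Suc k)) y"
  shows "bd k (bd (Suc k) v) = 0"
proof -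
  have "bd (Suc k) ` free_module m (b (Suc (Suc k))) = {v \<in> free_module m (b (Suc k)). bd k v = (\<lambda>_. 0)}"
    using resolution unfolding minimal_graded_free_resolution_def bd_def by blast
  moreover have "v \<in> free_module m (b (Suc (Suc k)))" using assms by (simp add: piece_def)
  ultimately have "bd (Suc k) v \<in> {v \<in> free_module m (b (Suc k)). bd k v = (\<lambda>_. 0)}"
    by (metis imageI)
  then show ?thesis by (simp add: zero_fun_def)
qed

text \<open>Total degree \<open>x\<close> in the tensor product of \<open>F_k\<close> with the
  \<open>p\<close>-th exterior power, \<open>e_I\<close> having degree
  \<open>degs d I\<close>.\<close>

abbreviation module_forms :: "int \<Rightarrow> nat \<Rightarrow> nat \<Rightarrow> (nat set \<Rightarrow> nat \<Rightarrow> 'k mpolynomial) set" where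
  "module_forms x k \<equiv> forms m (\<lambda>I. piece k (x - degs d I))"

text \<open>The same with the semigroup ring in place of \<open>F_k\<close>: its piece of degree
  \<open>y\<close> is \<open>k\<close> if \<open>y\<close> lies in the semigroup and 0 otherwise.
  These are the chains of the complex of all \<open>I\<close> with \<open>x - degs d I\<close> in
  the semigroup.\<close>

abbreviation scalar_forms :: "int \<Rightarrow> nat \<Rightarrow> (nat set \<Rightarrow> 'k) set" where
  "scalar_forms x \<equiv> forms m (\<lambda>I. {a. x - degs d I \<in> semigroup_of m d \<or> a = 0})"

abbreviation scalar_koszul :: "(nat set \<Rightarrow> 'k) \<Rightarrow> nat set \<Rightarrow> 'k" where
  "scalar_koszul \<equiv> koszul m (\<lambda>l a. a)"

lemma bd_in_module_forms:
  assumes "w \<in> module_forms x (Suc k) p"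
  shows "(\<lambda>I. bd k (w I)) \<in> module_forms x k p"
  using forms_mem[OF assms]
  by (intro formsI) (auto simp: bd_in_piece additive.zero[OF additive_bd])

lemma koszul_in_module_forms:
  assumes "w \<in> module_forms x k (Suc p)"
  shows "koszul m smul w \<in> module_forms x k p"
proof (rule koszul_in_forms[OF assms add_closed_piece additive_smul])
  fix I l v assume *: "I \<subseteq> {1..m}" "l \<in> {1..m} - I" "v \<in> piece k (x - degs d (insert l I))"
  then have "finite I" using finite_subset by blast
  then have "x - degs d (insert l I) + int (d l) = x - degs d I"
    using * by (simp add: degs_insert)
  then show "smul l v \<in> piece k (x - degs d I)"
    using smul_in_piece[OF *(3), of l] *(2) by (metis DiffD1)
qed

lemma module_forms_piece: "w \<in> module_forms x k p \<Longrightarrow> w I \<in> piece k (x - degs d I)"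
  using forms_mem_add_closed[of w m "\<lambda>I. piece k (x - degs d I)" p I] add_closed_piece by blast

text \<open>Dividing by the least variable contracts the Koszul complex of a free module. Only
  constant terms of the coefficient at \<open>{}\<close> escape the contraction, and
  \<open>aug\<close> rules them out.\<close>

lemma koszul_exact:
  assumes w: "w \<in> module_forms x k p" and cycle: "\<And>I. koszul m smul w I = 0"
    and aug: "\<And>j. Poly_Mapping.lookup (w {} j) 0 = 0"
  shows "\<exists>u\<in>module_forms x k (Suc p). koszul m smul u = w"
proof
  let ?u = "\<lambda>I. if I \<subseteq> {1..m} then contraction squot w I else 0"
  show "?u \<in> module_forms x k (Suc p)"
  proof (rule forms_contraction[OF w additive_squot])
    fix I assume *: "I \<subseteq> {1..m}" "w (I - {Min I}) \<in> piece k (x - degs d (I - {Min I}))" "Min I \<in> I"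
    then have "finite I" using finite_subset by blast
    with * squot_in_piece[OF *(2), of "Min I"]
    show "squot (Min I) (w (I - {Min I})) \<in> piece k (x - degs d I)"
      by (simp add: degs_remove[of I "Min I"] algebra_simps)
  qed
  have polys: "w I j \<in> polys m" for I j
    using piece_component[OF module_forms_piece[OF w]] .
  show "koszul m smul ?u = w"
  proof
    fix I
    have "koszul m smul ?u I = koszul m smul (contraction squot w) I"
      by (rule koszul_cong) simp
    also have "\<dots> = w I"
    proof (cases "I \<subseteq> {1..m}")
      case True
      show ?thesis
      proof (rule koszul_contraction[OF additive_smul additive_squot])
        show "squot l (smul l' v) = smul l' (squot l v)" if "l < l'" for l l' v
          using that by (simp add: squot_def smul_def var_quot_mvar_times)
        show "squot l (smul l' v) = 0" if "l' < l" for l l' v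
          using that by (simp add: squot_def smul_def var_quot_mvar_times_eq_0 zero_fun_def)
        show "w I = (\<Sum>l = 1..<Min I. smul l (squot l (w I))) + squot (Min I) (smul (Min I) (w I))"
          if "I \<subseteq> {1..m}" "I \<noteq> {}" for I
        proof
          fix j
          have "Min I \<in> I" using that finite_subset by (intro Min_in) auto
          then have "Min I \<in> {1..m}" using that by auto
          from var_quot_split[OF polys this, of I j]
          show "w I j = ((\<Sum>l = 1..<Min I. smul l (squot l (w I))) + squot (Min I) (smul (Min I) (w I))) j"
            unfolding plus_fun_apply sum_fun_apply unfolding smul_def squot_def .
        qed
        show "w {} = (\<Sum>l = 1..m. smul l (squot l (w {})))"
        proof
          fix j
          from var_quot_split_augmentation[OF polys aug, of j]
          show "w {} j = (\<Sum>l = 1..m. smul l (squot l (w {}))) j"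
            unfolding sum_fun_apply unfolding smul_def squot_def .
        qed
      qed (use True cycle in auto)
    next
      case False
      then show ?thesis using forms_mem(2)[OF w, of I] by (simp add: koszul_def)
    qed
    finally show "koszul m smul ?u I = w I" .
  qed
qed

text \<open>Every semigroup element is the degree of some monomial, whose scalar multiples lift all
  of \<open>k\<close>; at other degrees the coefficient is 0 and lifts to 0.\<close>

lemma aug_lift:
  assumes "u \<in> scalar_forms x p"
  shows "\<exists>v\<in>module_forms x 0 p. \<forall>I. aug (v I) = u I"
proof -
  have "\<exists>v\<in>piece 0 y. aug v = a" if y: "y \<in> semigroup_of m d" for y and a :: 'k
  proof -
    obtain t where t: "Poly_Mapping.keys t \<subseteq> {1..m}" "int (wdeg d t) = y"
      using semigroup_monomial[OF y] .
    let ?v = "\<lambda>j. if j = 1 then Poly_Mapping.single t a else 0 :: 'k mpolynomial"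
    have "?v \<in> piece 0 y"
      using t degree_zero_module by (auto simp: piece_def free_module_def homog_def polys_def)
    moreover have "aug ?v = a" by (simp add: aug_def)
    ultimately show ?thesis by blast
  qed
  note surj = this
  have "\<exists>v. (I \<subseteq> {1..m} \<and> card I = p \<longrightarrow> v \<in> piece 0 (x - degs d I)) \<and>
      (\<not> (I \<subseteq> {1..m} \<and> card I = p) \<longrightarrow> v = 0) \<and> aug v = u I" for I
  proof (cases "I \<subseteq> {1..m} \<and> card I = p \<and> x - degs d I \<in> semigroup_of m d")
    case False
    then have "u I = 0" using forms_mem[OF assms, of I] by blast
    then show ?thesis
      using additive.zero[OF additive_aug] add_closed_piece[of 0 "x - degs d I"]
      unfolding add_closed_def by (intro exI[of _ 0]) simp
  next
    case True
    then obtain v where "v \<in> piece 0 (x - degs d I)" "aug v = u I" using surj by blast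
    then show ?thesis using True by blast
  qed
  then obtain v where v: "\<And>I. (I \<subseteq> {1..m} \<and> card I = p \<longrightarrow> v I \<in> piece 0 (x - degs d I)) \<and>
      (\<not> (I \<subseteq> {1..m} \<and> card I = p) \<longrightarrow> v I = 0) \<and> aug (v I) = u I" by metis
  then have "v \<in> module_forms x 0 p" by (intro formsI) auto
  with v show ?thesis by blast
qed

lemma aug_in_scalar_forms:
  assumes "w \<in> module_forms x 0 p"
  shows "(\<lambda>I. aug (w I)) \<in> scalar_forms x p"
proof (rule formsI)
  fix I assume *: "I \<subseteq> {1..m}" "card I = p"
  have "x - degs d I \<in> semigroup_of m d" if "aug (w I) \<noteq> 0"
  proof -
    have "w I 1 \<noteq> 0" using that additive.zero[OF additive_eval_ones] by (auto simp: aug_def)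
    then have "Poly_Mapping.keys (w I 1) \<noteq> {}" by simp
    then obtain t where t: "t \<in> Poly_Mapping.keys (w I 1)" by blast
    have "w I \<in> piece 0 (x - degs d I)" using forms_mem(1)[OF assms *] .
    then have "w I 1 \<in> polys m" "homog d (x - degs d I) (w I 1)"
      using degree_zero_module by (simp_all add: piece_def free_module_def)
    then show ?thesis using t wdeg_in_semigroup[of t m d] by (auto simp: polys_def homog_def)
  qed
  then show "aug (w I) \<in> {a. x - degs d I \<in> semigroup_of m d \<or> a = 0}" by blast
next
  fix I assume "\<not> (I \<subseteq> {1..m} \<and> card I = p)"
  then show "aug (w I) = 0" using forms_mem(2)[OF assms] by (simp add: additive.zero[OF additive_aug])
qed

lemma aug_koszul: "aug (koszul m smul w I) = scalar_koszul (\<lambda>I. aug (w I)) I"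
  by (rule koszul_additive_comm[of aug smul "\<lambda>l a. a", OF additive_aug aug_smul])

lemma bd_koszul: "bd k (koszul m smul w I) = koszul m smul (\<lambda>I. bd k (w I)) I"
  by (rule koszul_additive_comm[of "bd k" smul smul, OF additive_bd bd_smul])

text \<open>
  The zigzag through the double complex of the resolution and the Koszul complex, which computes
  \<open>Tor\<close> in degree \<open>x\<close> both ways.
\<close>

lemma zigzag:
  assumes "w \<in> module_forms x k p"
    and "case k of 0 \<Rightarrow> (\<forall>I. aug (koszul m smul w I) = 0)
      | Suc k' \<Rightarrow> (\<forall>I. bd k' (koszul m smul w I) = 0)"
  shows "\<exists>a\<in>scalar_forms x (k + p). (\<forall>I. scalar_koszul a I = 0) \<and>
    ((\<exists>u\<in>scalar_forms x (Suc (k + p)). scalar_koszul u = a) \<longrightarrow>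
     (\<exists>v\<in>module_forms x (Suc k) p. \<exists>v'\<in>module_forms x k (Suc p).
       w = (\<lambda>I. bd k (v I) + koszul m smul v' I)))"
  using assms
proof (induction k arbitrary: w p)
  case 0
  show ?case
  proof (rule bexI, intro conjI allI impI)
    show "(\<lambda>I. aug (w I)) \<in> scalar_forms x (0 + p)"
      using aug_in_scalar_forms[OF 0(1)] by simp
    show "scalar_koszul (\<lambda>I. aug (w I)) I = 0" for I
      using 0(2) by (simp add: aug_koszul)
    assume "\<exists>u\<in>scalar_forms x (Suc (0 + p)). scalar_koszul u = (\<lambda>I. aug (w I))"
    then obtain u where u: "u \<in> scalar_forms x (Suc p)" "scalar_koszul u = (\<lambda>I. aug (w I))" by auto
    obtain v' where v': "v' \<in> module_forms x 0 (Suc p)" "\<And>I. aug (v' I) = u I"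
      using aug_lift[OF u(1)] by blast
    \<comment> \<open>Once the Koszul boundary of a lift of \<open>u\<close> is subtracted, the
      augmentation vanishes and exactness at \<open>F_0\<close> supplies \<open>v\<close>.\<close>
    let ?z = "\<lambda>I. w I - koszul m smul v' I"
    have z: "?z \<in> module_forms x 0 p"
      using 0(1) koszul_in_module_forms[OF v'(1)] add_closed_piece by (rule forms_diff)
    have "aug (?z I) = 0" for I
      using u(2) v'(2) by (simp add: additive.diff[OF additive_aug] aug_koszul fun_eq_iff)
    then have "\<exists>v\<in>piece 1 (x - degs d I). bd 0 v = ?z I" for I
      using aug_exact[OF module_forms_piece[OF z], of I] by blast
    then have "\<exists>v. (I \<subseteq> {1..m} \<and> card I = p \<longrightarrow> v \<in> piece 1 (x - degs d I)) \<and>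
      (\<not> (I \<subseteq> {1..m} \<and> card I = p) \<longrightarrow> v = 0) \<and> bd 0 v = ?z I" for I
      using forms_mem(2)[OF z, of I] additive.zero[OF additive_bd] by metis
    then obtain v where v: "\<And>I. (I \<subseteq> {1..m} \<and> card I = p \<longrightarrow> v I \<in> piece 1 (x - degs d I)) \<and>
      (\<not> (I \<subseteq> {1..m} \<and> card I = p) \<longrightarrow> v I = 0) \<and> bd 0 (v I) = ?z I" by metis
    then have "v \<in> module_forms x (Suc 0) p" by (intro formsI) auto
    moreover have "w = (\<lambda>I. bd 0 (v I) + koszul m smul v' I)" using v by (simp add: fun_eq_iff)
    ultimately show "\<exists>v\<in>module_forms x (Suc 0) p. \<exists>v'\<in>module_forms x 0 (Suc p).
        w = (\<lambda>I. bd 0 (v I) + koszul m smul v' I)"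
      using v'(1) by blast
  qed
next
  case (Suc k)
  let ?Dw = "\<lambda>I. bd k (w I)"
  \<comment> \<open>The image of \<open>w\<close> under the differential is a Koszul cycle, and by
    minimality it has no constant terms. It therefore bounds some \<open>w'\<close> over
    \<open>F_k\<close>, one step lower in the resolution and one form degree higher.\<close>
  have "koszul m smul ?Dw I = 0" for I
    using Suc.prems(2) by (simp add: bd_koszul[symmetric])
  then obtain w' where w': "w' \<in> module_forms x k (Suc p)" "koszul m smul w' = ?Dw"
    using koszul_exact[OF bd_in_module_forms[OF Suc.prems(1)]] lookup_bd_zero by blast
  have "case k of 0 \<Rightarrow> (\<forall>I. aug (koszul m smul w' I) = 0)
      | Suc k' \<Rightarrow> (\<forall>I. bd k' (koszul m smul w' I) = 0)"
  proof (cases k)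
    case 0
    then have "aug (bd 0 (w I)) = 0" for I
      using aug_exact[OF bd_in_piece] module_forms_piece[OF Suc.prems(1), of I] by auto
    then show ?thesis using 0 w'(2) by simp
  next
    case (Suc k')
    then show ?thesis using w'(2) bd_bd module_forms_piece[OF Suc.prems(1)] by auto
  qed
  from Suc.IH[OF w'(1) this] obtain a where a: "a \<in> scalar_forms x (Suc k + p)"
    "\<And>I. scalar_koszul a I = 0"
    "(\<exists>u\<in>scalar_forms x (Suc (Suc k + p)). scalar_koszul u = a) \<Longrightarrow>
     \<exists>v\<in>module_forms x (Suc k) (Suc p). \<exists>v'\<in>module_forms x k (Suc (Suc p)).
       w' = (\<lambda>I. bd k (v I) + koszul m smul v' I)"
    unfolding add_Suc_right add_Suc by blast
  show ?case
  proof (rule bexI[OF _ a(1)], intro conjI allI impI a(2))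
    assume "\<exists>u\<in>scalar_forms x (Suc (Suc k + p)). scalar_koszul u = a"
    from a(3)[OF this] obtain v v' where v: "v \<in> module_forms x (Suc k) (Suc p)"
      "w' = (\<lambda>I. bd k (v I) + koszul m smul v' I)" by blast
    let ?z = "\<lambda>I. w I - koszul m smul v I"
    have z: "?z \<in> module_forms x (Suc k) p"
      using Suc.prems(1) koszul_in_module_forms[OF v(1)] add_closed_piece by (rule forms_diff)
    \<comment> \<open>The part \<open>koszul m smul v'\<close> of \<open>w'\<close> drops out
      because the Koszul boundary squares to zero. Hence \<open>w\<close> and
      \<open>koszul m smul v\<close> have the same image under \<open>bd k\<close>, and exactness
      applies to their difference.\<close>
    have "koszul m smul w' I = bd k (koszul m smul v I)" for I
      unfolding v(2) bd_koszul
      by (simp add: koszul_add[OF additive_smul] koszul_koszul[OF additive_smul smul_commute])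
    then have "bd k (?z I) = 0" for I
      using w'(2) by (simp add: additive.diff[OF additive_bd] fun_eq_iff)
    then have "\<exists>v\<in>piece (Suc (Suc k)) (x - degs d I). bd (Suc k) v = ?z I" for I
      using bd_exact[OF module_forms_piece[OF z], of I] by blast
    then have "\<exists>u. (I \<subseteq> {1..m} \<and> card I = p \<longrightarrow> u \<in> piece (Suc (Suc k)) (x - degs d I)) \<and>
      (\<not> (I \<subseteq> {1..m} \<and> card I = p) \<longrightarrow> u = 0) \<and> bd (Suc k) u = ?z I" for I
      using forms_mem(2)[OF z, of I] additive.zero[OF additive_bd] by metis
    then obtain u where u: "\<And>I. (I \<subseteq> {1..m} \<and> card I = p \<longrightarrow> u I \<in> piece (Suc (Suc k)) (x - degs d I)) \<and>
      (\<not> (I \<subseteq> {1..m} \<and> card I = p) \<longrightarrow> u I = 0) \<and> bd (Suc k) (u I) = ?z I" by metis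
    then have "u \<in> module_forms x (Suc (Suc k)) p" by (intro formsI) auto
    moreover have "w = (\<lambda>I. bd (Suc k) (u I) + koszul m smul v I)" using u by (simp add: fun_eq_iff)
    ultimately show "\<exists>v\<in>module_forms x (Suc (Suc k)) p. \<exists>v'\<in>module_forms x (Suc k) (Suc p).
        w = (\<lambda>I. bd (Suc k) (v I) + koszul m smul v' I)"
      using v(1) by blast
  qed
qed

text \<open>The zigzag starts from the \<open>j\<close>-th basis vector as a 0-form. If the
  resulting cycle were a boundary, this vector would be an element of the image of
  \<open>bd i\<close> plus a combination of multiples of variables; both have constant term 0, the
  first by minimality, while its \<open>j\<close>-th coordinate is 1.\<close>

lemma basis_degree_koszul_homology:
  assumes "j \<in> {1..b i}"
  shows "\<exists>a\<in>scalar_forms (int (c j i)) i. (\<forall>I. scalar_koszul a I = 0) \<and>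
    \<not> (\<exists>u\<in>scalar_forms (int (c j i)) (Suc i). scalar_koszul u = a)"
proof -
  let ?x = "int (c j i)"
  let ?e = "\<lambda>r. if r = j then 1 else 0 :: 'k mpolynomial"
  let ?w = "\<lambda>I. if I = {} then ?e else 0"
  have "?e \<in> piece i ?x"
    using assms by (auto simp: piece_def free_module_def polys_def homog_def)
  moreover have "card I = 0 \<longleftrightarrow> I = {}" if "I \<subseteq> {1..m}" for I
    using finite_subset[OF that] by simp
  ultimately have w: "?w \<in> module_forms ?x i 0"
    by (intro formsI) (auto simp: degs_def)
  have "koszul m smul ?w I = 0" for I
    by (simp add: koszul_def additive.zero[OF additive_smul])
  then have cyc: "case i of 0 \<Rightarrow> (\<forall>I. aug (koszul m smul ?w I) = 0)
      | Suc k' \<Rightarrow> (\<forall>I. bd k' (koszul m smul ?w I) = 0)"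
    by (simp add: additive.zero[OF additive_aug] additive.zero[OF additive_bd] split: nat.split)
  have "\<not> (\<exists>v\<in>module_forms ?x (Suc i) 0. \<exists>v'\<in>module_forms ?x i (Suc 0).
       ?w = (\<lambda>I. bd i (v I) + koszul m smul v' I))"
  proof
    assume "\<exists>v\<in>module_forms ?x (Suc i) 0. \<exists>v'\<in>module_forms ?x i (Suc 0).
       ?w = (\<lambda>I. bd i (v I) + koszul m smul v' I)"
    then obtain v v' where "?w = (\<lambda>I. bd i (v I) + koszul m smul v' I)" by blast
    from fun_cong[OF this, of "{}"]
    have "?e = bd i (v {}) + koszul m smul v' {}" by (simp only: if_True simp_thms)
    from fun_cong[OF this, of j]
    have "1 = bd i (v {}) j + koszul m smul v' {} j" by (simp only: if_True simp_thms plus_fun_apply)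
    then have "Poly_Mapping.lookup (1 :: 'k mpolynomial) 0 =
        Poly_Mapping.lookup (bd i (v {}) j + koszul m smul v' {} j) 0" by (rule arg_cong)
    also have "\<dots> = Poly_Mapping.lookup (bd i (v {}) j + (\<Sum>l = 1..m. ksgn l {} (smul l (v' {l}))) j) 0"
      by (simp add: koszul_def)
    also have "\<dots> = (\<Sum>l = 1..m. Poly_Mapping.lookup (smul l (v' {l}) j) 0)"
      by (simp add: lookup_add lookup_bd_zero sum_fun_apply ksgn_def lookup_sum)
    also have "\<dots> = 0"
      by (simp add: smul_def lookup_times_zero)
    finally show False by simp
  qed
  with zigzag[OF w cyc] show ?thesis by auto
qed

text \<open>If all sets of size \<open>i + 1\<close> were admissible in degree \<open>c j i\<close>,
  coning with apex 1 would stay inside the scalar forms and make every cycle of degree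
  \<open>i\<close> a boundary.\<close>

lemma basis_degree_obstruction:
  assumes "1 \<le> m" "j \<in> {1..b i}"
  shows "\<exists>J\<subseteq>{1..m}. card J = Suc i \<and> int (c j i) - degs d J \<notin> semigroup_of m d"
proof (rule ccontr)
  assume *: "\<not> ?thesis"
  let ?x = "int (c j i)"
  obtain a where a: "a \<in> scalar_forms ?x i" "\<And>I. scalar_koszul a I = 0"
    "\<not> (\<exists>u\<in>scalar_forms ?x (Suc i). scalar_koszul u = a)"
    using basis_degree_koszul_homology[OF assms(2)] by blast
  let ?sh = "\<lambda>l a. if l = 1 then a else 0 :: 'k"
  let ?u = "\<lambda>I. if I \<subseteq> {1..m} then contraction ?sh a I else 0"
  have "?u \<in> scalar_forms ?x (Suc i)"
    by (rule forms_contraction[OF a(1)]) (use * in \<open>auto simp: additive_def\<close>)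
  moreover have "scalar_koszul ?u = a"
  proof
    fix I
    have "scalar_koszul ?u I = scalar_koszul (contraction ?sh a) I"
      by (rule koszul_cong) simp
    also have "\<dots> = a I"
    proof (cases "I \<subseteq> {1..m}")
      case True
      then show ?thesis using koszul_scalar_contraction[OF assms(1) a(2)] by blast
    next
      case False
      then show ?thesis using forms_mem(2)[OF a(1), of I] by (simp add: koszul_def)
    qed
    finally show "scalar_koszul ?u I = a I" .
  qed
  ultimately show False using a(3) by blast
qed

text \<open>The obstructing set has \<open>m\<close> elements, so it is everything. A nonzero cycle
  on the sets of size \<open>m - 1\<close> must be nonzero on each of them, as it is a multiple of
  the fundamental cycle of the boundary of the simplex.\<close>

lemma top_basis_degree:
  assumes "1 \<le> m" "j \<in> {1..b (m - 1)}"
  shows "int (c j (m - 1)) - degs d {1..m} \<notin> semigroup_of m d"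
    and "\<And>l. l \<in> {1..m} \<Longrightarrow> int (c j (m - 1)) - degs d ({1..m} - {l}) \<in> semigroup_of m d"
proof -
  let ?x = "int (c j (m - 1))"
  obtain J where J: "J \<subseteq> {1..m}" "card J = Suc (m - 1)" "?x - degs d J \<notin> semigroup_of m d"
    using basis_degree_obstruction[OF assms] by blast
  then have "J = {1..m}" using assms(1) by (intro card_subset_eq) auto
  with J show "?x - degs d {1..m} \<notin> semigroup_of m d" by simp
  obtain a where a: "a \<in> scalar_forms ?x (m - 1)" "\<And>I. scalar_koszul a I = 0"
    "\<not> (\<exists>u\<in>scalar_forms ?x (Suc (m - 1)). scalar_koszul u = a)"
    using basis_degree_koszul_homology[OF assms(2)] by blast
  have "\<exists>I. a I \<noteq> 0"
  proof (rule ccontr)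
    assume "\<not> (\<exists>I. a I \<noteq> 0)"
    then have "scalar_koszul (\<lambda>_. 0) = a" by (simp add: koszul_def fun_eq_iff)
    moreover have "(\<lambda>_. 0) \<in> scalar_forms ?x (Suc (m - 1))" by (rule formsI) simp_all
    ultimately show False using a(3) by blast
  qed
  then obtain I where "a I \<noteq> 0" by blast
  then have I: "I \<subseteq> {1..m}" "card I = m - 1" using forms_mem(2)[OF a(1), of I] by auto
  then have "card ({1..m} - I) = 1"
    using assms(1) finite_subset[OF I(1)] by (simp add: card_Diff_subset)
  then obtain i where "{1..m} - I = {i}" by (auto simp: card_1_singleton_iff)
  then have i: "i \<in> {1..m}" "I = {1..m} - {i}" using I by auto
  show "?x - degs d ({1..m} - {l}) \<in> semigroup_of m d" if l: "l \<in> {1..m}" for l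
  proof -
    have "a ({1..m} - {l}) \<noteq> 0"
    proof (cases "l = i")
      case True
      then show ?thesis using i \<open>a I \<noteq> 0\<close> by simp
    next
      case False
      \<comment> \<open>Only two sets of size \<open>m - 1\<close> contain \<open>?K\<close>, so the
        cycle condition there equates their coefficients up to sign.\<close>
      let ?K = "{1..m} - {i, l}"
      have "{1..m} - ?K = {i, l}" using i l by auto
      moreover have "insert i ?K = {1..m} - {l}" "insert l ?K = {1..m} - {i}"
        using i l False by auto
      ultimately have "ksgn i ?K (a ({1..m} - {l})) + ksgn l ?K (a ({1..m} - {i})) = 0"
        using a(2)[of ?K] False by (simp add: koszul_def)
      then show ?thesis using i \<open>a I \<noteq> 0\<close> by auto
    qed
    moreover have "card ({1..m} - {l}) = m - 1" using l by simp
    ultimately show ?thesis using forms_mem(1)[OF a(1), of "{1..m} - {l}"] by blast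
  qed
qed

end

section \<open>The semigroup and its Hilbert series\<close>

lemma semigroup_nonneg: "s \<in> semigroup_of m d \<Longrightarrow> 0 \<le> s"
  by (auto simp: semigroup_of_def intro!: sum_nonneg)

lemma zero_in_semigroup: "0 \<in> semigroup_of m d"
  unfolding semigroup_of_def by (auto intro!: exI[of _ "\<lambda>_. 0"])

lemma add_in_semigroup:
  assumes "s \<in> semigroup_of m d" "t \<in> semigroup_of m d"
  shows "s + t \<in> semigroup_of m d"
proof -
  obtain x y :: "nat \<Rightarrow> nat" where "s = (\<Sum>i=1..m. int (x i * d i))" "t = (\<Sum>i=1..m. int (y i * d i))"
    using assms by (auto simp: semigroup_of_def)
  then have "s + t = (\<Sum>i=1..m. int ((x i + y i) * d i))"
    by (simp add: sum.distrib algebra_simps)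
  then show ?thesis unfolding semigroup_of_def by (auto intro!: exI[of _ "\<lambda>i. x i + y i"])
qed

lemma degs_in_semigroup:
  assumes "J \<subseteq> {1..m}"
  shows "degs d J \<in> semigroup_of m d"
proof -
  have "degs d J = (\<Sum>i=1..m. int (of_bool (i \<in> J) * d i))"
    unfolding degs_def of_nat_sum using assms
    by (intro sum.mono_neutral_cong_left) auto
  then show ?thesis unfolding semigroup_of_def by (auto intro!: exI[of _ "\<lambda>i. of_bool (i \<in> J)"])
qed

lemma semigroup_nonzero_cases:
  assumes "s \<in> semigroup_of m d" "s \<noteq> 0"
  obtains l where "l \<in> {1..m}" "s - int (d l) \<in> semigroup_of m d"
proof -
  obtain x :: "nat \<Rightarrow> nat" where s: "s = (\<Sum>i=1..m. int (x i * d i))"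
    using assms(1) by (auto simp: semigroup_of_def)
  with assms(2) obtain l where l: "l \<in> {1..m}" "int (x l * d l) \<noteq> 0"
    by (metis (no_types, lifting) sum.neutral)
  define y where "y = x(l := x l - 1)"
  have "x l * d l = y l * d l + d l"
    using l(2) by (cases "x l") (auto simp: y_def)
  moreover have "(\<Sum>i\<in>{1..m} - {l}. int (x i * d i)) = (\<Sum>i\<in>{1..m} - {l}. int (y i * d i))"
    by (rule sum.cong) (auto simp: y_def)
  ultimately have "s - int (d l) = (\<Sum>i=1..m. int (y i * d i))"
    unfolding s using l(1) by (simp add: sum.remove[of _ l] flip: of_nat_mult)
  then have "s - int (d l) \<in> semigroup_of m d"
    unfolding semigroup_of_def by blast
  with l(1) show thesis by (rule that)
qed

lemma mult_in_semigroup: "s \<in> semigroup_of m d \<Longrightarrow> int k * s \<in> semigroup_of m d"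
  by (induction k) (simp_all add: zero_in_semigroup add_in_semigroup distrib_right)

lemma bezout_finite:
  fixes d :: "'a \<Rightarrow> nat"
  assumes "finite A"
  shows "\<exists>u. (\<Sum>i\<in>A. u i * int (d i)) = int (Gcd (d ` A))"
  using assms
proof (induction A rule: finite_induct)
  case (insert i A)
  then obtain u where u: "(\<Sum>i\<in>A. u i * int (d i)) = int (Gcd (d ` A))" by blast
  obtain v w where vw: "v * int (d i) + w * int (Gcd (d ` A)) = gcd (int (d i)) (int (Gcd (d ` A)))"
    using bezout_int by blast
  let ?u = "\<lambda>j. if j = i then v else w * u j"
  have "(\<Sum>j\<in>insert i A. ?u j * int (d j)) = v * int (d i) + (\<Sum>j\<in>A. w * (u j * int (d j)))"
    using insert.hyps by (auto simp: mult.assoc intro!: sum.cong)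
  also have "\<dots> = int (Gcd (d ` insert i A))"
    by (simp add: sum_distrib_left[symmetric] u vw)
  finally show ?case by (intro exI[of _ ?u])
qed simp

lemma semigroup_cofinite:
  assumes "Gcd (d ` {1..m}) = 1"
  obtains N where "\<And>y. N \<le> y \<Longrightarrow> y \<in> semigroup_of m d"
proof -
  obtain u where u: "(\<Sum>i=1..m. u i * int (d i)) = 1"
    using bezout_finite[of "{1..m}" d] assms by auto
  \<comment> \<open>The negative and the positive part of the Bezout combination are two consecutive
    elements \<open>t\<close> and \<open>t + 1\<close> of the semigroup.\<close>
  define t where "t = (\<Sum>i=1..m. int (nat (- u i) * d i))"
  have t: "t \<in> semigroup_of m d"
    unfolding t_def semigroup_of_def by (auto intro!: exI[of _ "\<lambda>i. nat (- u i)"])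
  have "t + 1 = (\<Sum>i=1..m. (int (nat (- u i)) + u i) * int (d i))"
    unfolding t_def u[symmetric] by (simp add: sum.distrib distrib_right)
  also have "\<dots> = (\<Sum>i=1..m. int (nat (u i) * d i))"
    by (rule sum.cong) auto
  finally have t1: "t + 1 \<in> semigroup_of m d"
    unfolding semigroup_of_def by (auto intro!: exI[of _ "\<lambda>i. nat (u i)"])
  have "y \<in> semigroup_of m d" if y: "t * t \<le> y" for y
  proof (cases "t = 0")
    case True
    then show ?thesis using mult_in_semigroup[OF t1, of "nat y"] y by simp
  next
    case False
    then have "0 < t" using semigroup_nonneg[OF t] by simp
    then have "y mod t < t" "0 \<le> y mod t" by simp_all
    moreover have "t \<le> y div t" using zdiv_mono1[OF y \<open>0 < t\<close>] \<open>0 < t\<close> by simp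
    \<comment> \<open>With quotient at least \<open>t\<close> and remainder below \<open>t\<close>,
      the difference is positive and \<open>nat\<close> does not truncate it.\<close>
    ultimately have "int (nat (y div t - y mod t)) * t + int (nat (y mod t)) * (t + 1) = y"
      by (simp add: algebra_simps)
    then show ?thesis
      using add_in_semigroup[OF mult_in_semigroup[OF t] mult_in_semigroup[OF t1]] by metis
  qed
  then show thesis by (rule that)
qed

lemma frobenius_props:
  assumes "Gcd (d ` {1..m}) = 1"
  shows "frobenius (semigroup_of m d) \<notin> semigroup_of m d"
    and "\<And>y. frobenius (semigroup_of m d) < y \<Longrightarrow> y \<in> semigroup_of m d"
proof -
  let ?S = "semigroup_of m d"
  obtain N where N: "\<And>y. N \<le> y \<Longrightarrow> y \<in> ?S" using semigroup_cofinite[OF assms] by blast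
  let ?G = "{y. - 1 \<le> y \<and> y < N \<and> y \<notin> ?S}"
  have "?G \<subseteq> {- 1..<N}" by auto
  then have fin: "finite ?G" using finite_subset by blast
  have "- 1 \<notin> ?S" using semigroup_nonneg[of "- 1" m d] by auto
  then have "- 1 \<in> ?G" using N[of "- 1"] by force
  then have M: "Max ?G \<in> ?G" "- 1 \<le> Max ?G" using Max_in[OF fin] Max_ge[OF fin] by auto
  have ge: "y \<le> Max ?G" if "y \<notin> ?S" for y
  proof (cases "- 1 \<le> y")
    case True
    then have "y \<in> ?G" using that N[of y] by force
    then show ?thesis using Max_ge[OF fin] by blast
  qed (use M in simp)
  have F: "frobenius ?S = Max ?G"
    unfolding frobenius_def using M(1) ge by (intro Greatest_equality) auto
  show "frobenius ?S \<notin> ?S" using M(1) F by auto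
  show "y \<in> ?S" if "frobenius ?S < y" for y using ge[of y] that F by auto
qed

section \<open>Coefficients of the numerator as alternating sums over subsets\<close>

lemma count_image_mset_set:
  assumes "finite A"
  shows "count (image_mset f (mset_set A)) y = (\<Sum>x\<in>A. of_bool (f x = y))"
  using assms by (induction A rule: finite_induct) auto

lemma sum_alternating_subsets:
  assumes "finite A" "A \<noteq> {}"
  shows "(\<Sum>I\<in>Pow A. (-1) ^ card I) = (0 :: 'a::comm_ring_1)"
  using prod_diff_conv_sum[OF assms(1), of "\<lambda>_. 1 :: 'a" "\<lambda>_. 1"] assms
  by (simp add: power_0_left)

text \<open>The Euler characteristic of the Koszul complex of the semigroup ring in degree
  \<open>x\<close>; for \<open>x \<ge> 0\<close> it is the coefficient of \<open>z^x\<close> in the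
  numerator \<open>Q\<close>.\<close>

definition koszul_char :: "nat \<Rightarrow> (nat \<Rightarrow> nat) \<Rightarrow> int \<Rightarrow> int" where
  "koszul_char m d x = (\<Sum>I\<in>Pow {1..m}. (-1) ^ card I * of_bool (x - degs d I \<in> semigroup_of m d))"

lemma hilbert_numerator_nth:
  assumes "hilbert_series (semigroup_of m d) = N / (\<Prod>j=1..m. 1 - fps_X ^ d j)"
    and pos: "\<forall>i\<in>{1..m}. 0 < d i"
  shows "fps_nth N k = of_int (koszul_char m d (int k))"
proof -
  let ?H = "hilbert_series (semigroup_of m d)" and ?P = "\<Prod>j=1..m. 1 - fps_X ^ d j :: rat fps"
  have "fps_nth ?P 0 = (\<Prod>j=1..m. fps_nth (1 - fps_X ^ d j) 0)"
    by (induction m) (simp_all)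
  also have "\<dots> = 1" using pos by (intro prod.neutral) auto
  finally have "fps_nth ?P 0 \<noteq> 0" by simp
  then have "N = ?H * ?P"
    using assms(1) by (simp add: fps_divide_unit mult.assoc inverse_mult_eq_1)
  also have "?P = (\<Sum>I\<in>Pow {1..m}. (-1) ^ card I * fps_X ^ (\<Sum>j\<in>I. d j))"
    using prod_diff_conv_sum[of "{1..m}" "\<lambda>_. 1" "\<lambda>j. fps_X ^ d j :: rat fps"]
    by (simp add: power_sum)
  also have "?H * \<dots> = (\<Sum>I\<in>Pow {1..m}. (-1) ^ card I * (fps_X ^ (\<Sum>j\<in>I. d j) * ?H))"
    by (simp add: sum_distrib_left mult_ac)
  finally have "fps_nth N k = (\<Sum>I\<in>Pow {1..m}. fps_nth ((-1) ^ card I * (fps_X ^ (\<Sum>j\<in>I. d j) * ?H)) k)"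
    by (simp add: fps_sum_nth)
  also have "\<dots> = (\<Sum>I\<in>Pow {1..m}. (-1) ^ card I * of_bool (int k - degs d I \<in> semigroup_of m d))"
  proof (rule sum.cong)
    fix I :: "nat set"
    have "fps_nth ((-1) ^ card I * G) k = (-1) ^ card I * fps_nth G k" for G :: "rat fps"
      by (cases "even (card I)") simp_all
    moreover have "fps_nth (fps_X ^ (\<Sum>j\<in>I. d j) * ?H) k = of_bool (int k - degs d I \<in> semigroup_of m d)"
      using semigroup_nonneg[of "int k - degs d I" m d]
      unfolding degs_def fps_X_power_mult_nth hilbert_series_def by (auto simp del: of_nat_sum simp: of_nat_diff)
    ultimately show "fps_nth ((-1) ^ card I * (fps_X ^ (\<Sum>j\<in>I. d j) * ?H)) k =
        (-1) ^ card I * of_bool (int k - degs d I \<in> semigroup_of m d)" by simp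
  qed simp
  also have "\<dots> = of_int (koszul_char m d (int k))"
    by (simp add: koszul_char_def)
  finally show ?thesis .
qed

lemma degs_nonneg: "0 \<le> degs d I"
  unfolding degs_def by (rule of_nat_0_le_iff)

text \<open>Comparison of coefficients for \<open>x \<ge> 0\<close>. For negative \<open>x\<close>
  both sides vanish; this case matters because the formula is also used at
  \<open>bar m d x\<close>.\<close>

lemma koszul_char_syzygies:
  assumes "hilbert_series (semigroup_of m d) =
      syz_numerator m \<beta> C / (\<Prod>j=1..m. 1 - fps_X ^ d j)"
    and pos: "\<forall>i\<in>{1..m}. 0 < d i"
  shows "koszul_char m d x =
    of_bool (x = 0) + (\<Sum>i=1..m-1. (-1) ^ i * int (count (syz_mset \<beta> C i) x))"
proof (cases "0 \<le> x")
  case True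
  define k where "k = nat x"
  have x: "x = int k" using True by (simp add: k_def)
  have cnt: "count (syz_mset \<beta> C i) x = (\<Sum>j=1..\<beta> i. of_bool (k = C j i))" for i
    unfolding syz_mset_def x count_image_mset_set[OF finite_atLeastAtMost] of_nat_eq_iff
    by (simp only: eq_commute)
  have "fps_nth ((-1) ^ i * G) k = (-1) ^ i * fps_nth G k" for i and G :: "rat fps"
    by (cases "even i") simp_all
  then have "fps_nth (syz_numerator m \<beta> C) k =
      of_bool (k = 0) + (\<Sum>i=1..m-1. (-1) ^ i * (\<Sum>j=1..\<beta> i. of_bool (k = C j i)))"
    by (simp add: syz_numerator_def fps_sum_nth of_bool_def)
  also have "\<dots> = of_bool (x = 0) + (\<Sum>i=1..m-1. (-1) ^ i * of_nat (count (syz_mset \<beta> C i) x))"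
    unfolding cnt of_nat_sum of_nat_of_bool unfolding x of_nat_eq_0_iff ..
  also have "\<dots> = (of_int (of_bool (x = 0) +
      (\<Sum>i=1..m-1. (-1) ^ i * int (count (syz_mset \<beta> C i) x))) :: rat)"
    by simp
  finally show ?thesis
    unfolding hilbert_numerator_nth[OF assms] x of_int_eq_iff .
next
  case False
  then have "x - degs d I \<notin> semigroup_of m d" for I
    using semigroup_nonneg[of "x - degs d I" m d] degs_nonneg[of d I] by linarith
  moreover have "count (syz_mset \<beta> C i) x = 0" for i
    using False by (auto simp: syz_mset_def count_image_mset_set)
  ultimately show ?thesis using False by (simp add: koszul_char_def)
qed

section \<open>The reflection at the Frobenius number\<close>

lemma degs_complement:
  assumes "I \<subseteq> {1..m}"
  shows "degs d ({1..m} - I) = int (gen_sum m d) - degs d I"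
proof -
  have "gen_sum m d = (\<Sum>j\<in>{1..m} - I. d j) + (\<Sum>j\<in>I. d j)"
    unfolding gen_sum_def using assms by (simp add: sum.subset_diff)
  then show ?thesis by (simp add: degs_def)
qed

text \<open>Each \<open>I\<close> is replaced by its complement, which keeps the sign because
  \<open>m\<close> is even.\<close>

lemma koszul_char_bar:
  assumes "even m"
  shows "koszul_char m d (bar m d x) = (\<Sum>I\<in>Pow {1..m}. (-1) ^ card I *
    of_bool (frobenius (semigroup_of m d) - (x - degs d I) \<in> semigroup_of m d))"
  unfolding koszul_char_def
proof (rule sum.reindex_bij_witness[of _ "\<lambda>I. {1..m} - I" "\<lambda>I. {1..m} - I"])
  fix I assume "I \<in> Pow {1..m}"
  then have I: "I \<subseteq> {1..m}" "finite I" using finite_subset by auto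
  then have "card I + card ({1..m} - I) = m"
    using card_mono[of "{1..m}" I] by (simp add: card_Diff_subset)
  then have "even (card I) \<longleftrightarrow> even (card ({1..m} - I))" using assms by (metis even_add)
  then have "(-1 :: int) ^ card ({1..m} - I) = (-1) ^ card I"
    by (cases "even (card I)") simp_all
  then show "(-1 :: int) ^ card ({1..m} - I) * of_bool (frobenius (semigroup_of m d) -
        (x - degs d ({1..m} - I)) \<in> semigroup_of m d) =
      (-1) ^ card I * of_bool (bar m d x - degs d I \<in> semigroup_of m d)"
    unfolding degs_complement[OF I(1)] bar_def by (simp add: algebra_simps)
qed auto

lemma semigroup_trichotomy:
  assumes "Gcd (d ` {1..m}) = 1"
  defines "S \<equiv> semigroup_of m d"
  shows "of_bool (y \<in> S) + of_bool (frobenius S - y \<in> S) + of_bool (y \<in> Delta_H S) = (1 :: int)"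
proof -
  have "\<not> (y \<in> S \<and> frobenius S - y \<in> S)"
    using add_in_semigroup[of y m d "frobenius S - y"] frobenius_props(1)[OF assms(1)]
    unfolding S_def by auto
  then show ?thesis by (auto simp: Delta_H_def)
qed

lemma finite_Delta_H:
  assumes "Gcd (d ` {1..m}) = 1"
  shows "finite (Delta_H (semigroup_of m d))"
proof -
  let ?S = "semigroup_of m d"
  have "Delta_H ?S \<subseteq> {0..frobenius ?S}"
  proof
    fix h assume h: "h \<in> Delta_H ?S"
    then have "\<not> frobenius ?S < h" "\<not> frobenius ?S < frobenius ?S - h"
      using frobenius_props(2)[OF assms] by (auto simp: Delta_H_def)
    then show "h \<in> {0..frobenius ?S}" by simp
  qed
  then show ?thesis using finite_subset by blast
qed

lemma count_L_mset:
  assumes "Gcd (d ` {1..m}) = 1"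
  shows "count (L_mset m d i) x =
    (\<Sum>I\<in>{I. I \<subseteq> {1..m} \<and> card I = i}. of_bool (x - degs d I \<in> Delta_H (semigroup_of m d)))"
proof -
  let ?\<Delta> = "Delta_H (semigroup_of m d)" and ?A = "{I. I \<subseteq> {1..m} \<and> card I = i}"
  have fin: "finite ?\<Delta>" "finite ?A" using finite_Delta_H[OF assms] by auto
  have "count (L_mset m d i) x = (\<Sum>(I, h)\<in>?A \<times> ?\<Delta>. of_bool (degs d I + h = x))"
    unfolding L_mset_def degs_def using fin
    by (subst count_image_mset_set) (simp_all only: finite_cartesian_product case_prod_unfold)
  also have "\<dots> = (\<Sum>I\<in>?A. \<Sum>h\<in>?\<Delta>. of_bool (degs d I + h = x))"
    by (rule sum.cartesian_product[symmetric])
  also have "\<dots> = (\<Sum>I\<in>?A. of_bool (x - degs d I \<in> ?\<Delta>))"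
  proof (rule sum.cong)
    fix I
    have "(\<Sum>h\<in>?\<Delta>. of_bool (degs d I + h = x)) = (\<Sum>h\<in>?\<Delta>. if h = x - degs d I then 1 else 0 :: nat)"
      by (rule sum.cong) auto
    then show "(\<Sum>h\<in>?\<Delta>. of_bool (degs d I + h = x)) = (of_bool (x - degs d I \<in> ?\<Delta>) :: nat)"
      using fin by simp
  qed simp
  finally show ?thesis .
qed

lemma sum_parity_split:
  fixes h :: "nat \<Rightarrow> int"
  assumes "finite A"
  shows "(\<Sum>i\<in>A. (-1) ^ i * h i) = (\<Sum>i\<in>{i\<in>A. even i}. h i) - (\<Sum>i\<in>{i\<in>A. odd i}. h i)"
proof -
  have "(\<Sum>i\<in>A. (-1) ^ i * h i) = (\<Sum>i\<in>A. (if even i then h i else 0) - (if odd i then h i else 0))"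
    by (rule sum.cong) auto
  then show ?thesis using assms by (simp add: sum_subtractf sum.inter_filter)
qed

text \<open>The subsets are grouped by size. Sizes 0 and \<open>m\<close>, both even, are missing
  from \<open>L_even\<close> and give the two separate terms.\<close>

lemma count_L_alternating:
  assumes "Gcd (d ` {1..m}) = 1" "even m" "1 \<le> m"
  defines "\<Delta> \<equiv> Delta_H (semigroup_of m d)"
  shows "(\<Sum>I\<in>Pow {1..m}. (-1) ^ card I * of_bool (x - degs d I \<in> \<Delta>)) =
    of_bool (x \<in> \<Delta>) + of_bool (x - int (gen_sum m d) \<in> \<Delta>) +
    int (count (L_even m d) x) - int (count (L_odd m d) x)"
proof -
  let ?h = "\<lambda>i. int (count (L_mset m d i) x)"
  have "(\<Sum>I\<in>Pow {1..m}. (-1) ^ card I * of_bool (x - degs d I \<in> \<Delta>)) =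
      (\<Sum>i\<in>{..m}. \<Sum>I\<in>{I\<in>Pow {1..m}. card I = i}. (-1) ^ card I * of_bool (x - degs d I \<in> \<Delta>))"
    using card_mono[of "{1..m}"] by (intro sum.group[symmetric]) auto
  also have "\<dots> = (\<Sum>i\<in>{..m}. (-1) ^ i * ?h i)"
    by (rule sum.cong) (simp_all add: count_L_mset[OF assms(1)] sum_distrib_left \<Delta>_def)
  also have "{..m} = insert 0 (insert m {1..m-1})" using assms(3) by auto
  also have "(\<Sum>i\<in>insert 0 (insert m {1..m-1}). (-1) ^ i * ?h i) =
      ?h 0 + ?h m + (\<Sum>i\<in>{1..m-1}. (-1) ^ i * ?h i)"
    using assms(2,3) by (subst sum.insert; simp)+
  also have "{I. I \<subseteq> {1..m} \<and> card I = 0} = {{}}"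
    using finite_subset[of _ "{1..m}"] by auto
  then have "?h 0 = of_bool (x \<in> \<Delta>)"
    by (simp add: count_L_mset[OF assms(1)] \<Delta>_def degs_def)
  also have "{I. I \<subseteq> {1..m} \<and> card I = m} = {{1..m}}"
    using card_subset_eq[of "{1..m}"] by auto
  then have "?h m = of_bool (x - int (gen_sum m d) \<in> \<Delta>)"
    by (simp add: count_L_mset[OF assms(1)] \<Delta>_def degs_def gen_sum_def)
  also have "(\<Sum>i\<in>{1..m-1}. (-1) ^ i * ?h i) = int (count (L_even m d) x) - int (count (L_odd m d) x)"
    unfolding sum_parity_split[OF finite_atLeastAtMost] L_even_def L_odd_def count_sum of_nat_sum ..
  finally show ?thesis by simp
qed

text \<open>The trichotomy at \<open>x - degs d I\<close>, summed over \<open>I\<close> with signs.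
  The constant 1 contributes the alternating sum over all subsets, which is 0; this plays the part
  of the sum of all \<open>z^x\<close> being annihilated.\<close>

lemma koszul_char_symmetry:
  assumes "Gcd (d ` {1..m}) = 1" "even m" "1 \<le> m"
  defines "\<Delta> \<equiv> Delta_H (semigroup_of m d)"
  shows "koszul_char m d x + koszul_char m d (bar m d x) + of_bool (x \<in> \<Delta>) +
    of_bool (x - int (gen_sum m d) \<in> \<Delta>) + int (count (L_even m d) x) = int (count (L_odd m d) x)"
proof -
  let ?S = "semigroup_of m d"
  let ?s = "\<lambda>I. (-1 :: int) ^ card I"
  have "koszul_char m d x + koszul_char m d (bar m d x) +
      (\<Sum>I\<in>Pow {1..m}. ?s I * of_bool (x - degs d I \<in> \<Delta>)) =
      (\<Sum>I\<in>Pow {1..m}. ?s I * (of_bool (x - degs d I \<in> ?S) +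
        of_bool (frobenius ?S - (x - degs d I) \<in> ?S) + of_bool (x - degs d I \<in> \<Delta>)))"
    unfolding koszul_char_bar[OF assms(2)] unfolding koszul_char_def
    by (simp only: sum.distrib distrib_left)
  also have "\<dots> = (\<Sum>I\<in>Pow {1..m}. ?s I)"
    unfolding \<Delta>_def semigroup_trichotomy[OF assms(1)] by simp
  also have "\<dots> = 0" using assms(3) by (intro sum_alternating_subsets) auto
  finally show ?thesis
    unfolding \<Delta>_def count_L_alternating[OF assms(1-3)] by simp
qed

section \<open>Degrees of the last syzygies\<close>

lemma pseudo_frobenius_add_degs:
  assumes "f \<in> pseudo_frobenius (semigroup_of m d)" "J \<subseteq> {1..m}" "J \<noteq> {}"
    and pos: "\<forall>i\<in>{1..m}. 0 < d i"
  shows "f + degs d J \<in> semigroup_of m d"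
proof -
  obtain l where l: "l \<in> J" using assms(3) by blast
  then have "0 < d l" using pos assms(2) by auto
  have "finite J" using assms(2) finite_subset by blast
  then have "degs d J = int (d l) + degs d (J - {l})" using l by (rule degs_remove)
  then have "degs d J \<noteq> 0" using \<open>0 < d l\<close> degs_nonneg[of d "J - {l}"] by linarith
  then show ?thesis
    using assms(1) degs_in_semigroup[OF assms(2)] by (auto simp: pseudo_frobenius_def)
qed

text \<open>Every proper subset is admissible, and only the full set fails. Without it the
  alternating sum over all subsets falls from 0 to \<open>- (-1)^m\<close>.\<close>

lemma koszul_char_pseudo_frobenius:
  assumes f: "x - int (gen_sum m d) \<in> pseudo_frobenius (semigroup_of m d)"
    and pos: "\<forall>i\<in>{1..m}. 0 < d i" and m: "even m" "1 \<le> m"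
  shows "koszul_char m d x = - 1"
proof -
  let ?S = "semigroup_of m d"
  have "of_bool (x - degs d I \<in> ?S) = (1 :: int) - of_bool (I = {1..m})" if "I \<subseteq> {1..m}" for I
  proof (cases "I = {1..m}")
    case True
    then show ?thesis using f by (simp add: pseudo_frobenius_def degs_def gen_sum_def)
  next
    case False
    then have "{1..m} - I \<noteq> {}" using that by auto
    from pseudo_frobenius_add_degs[OF f _ this pos] show ?thesis
      using degs_complement[OF that] False by simp
  qed
  then have "koszul_char m d x = (\<Sum>I\<in>Pow {1..m}. (-1) ^ card I * (1 - of_bool (I = {1..m})))"
    unfolding koszul_char_def by (intro sum.cong) simp_all
  also have "\<dots> = (\<Sum>I\<in>Pow {1..m}. (-1) ^ card I) -
      (\<Sum>I\<in>Pow {1..m}. if I = {1..m} then (-1) ^ m else 0)"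
    unfolding sum_subtractf[symmetric] by (rule sum.cong) auto
  also have "\<dots> = - 1"
  proof -
    have "(\<Sum>I\<in>Pow {1..m}. (-1 :: int) ^ card I) = 0"
      using m by (intro sum_alternating_subsets) auto
    then show ?thesis using m by simp
  qed
  finally show ?thesis .
qed

context graded_resolution
begin

text \<open>A nonzero semigroup element is some \<open>d l\<close> plus another element, and
  \<open>?f + d l\<close> is in the semigroup because the set \<open>{1..m} - {l}\<close> is
  admissible.\<close>

lemma top_basis_degree_pseudo_frobenius:
  assumes "1 \<le> m" "j \<in> {1..b (m - 1)}"
  shows "int (c j (m - 1)) - int (gen_sum m d) \<in> pseudo_frobenius (semigroup_of m d)"
proof -
  let ?f = "int (c j (m - 1)) - int (gen_sum m d)"
  have "?f \<notin> semigroup_of m d"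
    using top_basis_degree(1)[OF assms] by (simp add: degs_def gen_sum_def)
  moreover have "?f + s \<in> semigroup_of m d" if s: "s \<in> semigroup_of m d - {0}" for s
  proof -
    obtain l where l: "l \<in> {1..m}" "s - int (d l) \<in> semigroup_of m d"
      using semigroup_nonzero_cases[of s m d] s by blast
    have "degs d ({1..m} - {l}) = int (gen_sum m d) - int (d l)"
      using degs_complement[of "{l}" m d] l(1) by (simp add: degs_def)
    then show ?thesis
      using add_in_semigroup[OF top_basis_degree(2)[OF assms l(1)] l(2)] by (simp add: algebra_simps)
  qed
  ultimately show ?thesis by (simp add: pseudo_frobenius_def)
qed

text \<open>An obstructing set of size \<open>i + 1 < m\<close> has a nonempty complement, yet
  adding the degrees of that complement to a pseudo-Frobenius number leads into the
  semigroup.\<close>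

lemma basis_degree_not_pseudo_frobenius:
  assumes pos: "\<forall>i\<in>{1..m}. 0 < d i" and i: "Suc i < m" and j: "j \<in> {1..b i}"
  shows "int (c j i) - int (gen_sum m d) \<notin> pseudo_frobenius (semigroup_of m d)"
proof
  assume f: "int (c j i) - int (gen_sum m d) \<in> pseudo_frobenius (semigroup_of m d)"
  obtain J where J: "J \<subseteq> {1..m}" "card J = Suc i" "int (c j i) - degs d J \<notin> semigroup_of m d"
    using basis_degree_obstruction[OF _ j] i by auto
  have "J \<noteq> {1..m}" using J(2) i by auto
  then have "{1..m} - J \<noteq> {}" using J(1) by auto
  from pseudo_frobenius_add_degs[OF f _ this pos] J(3) show False
    using degs_complement[OF J(1)] by simp
qed

text \<open>The inclusion \<open>sub\<close> confines the possible degrees, and the Hilbert series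
  fixes the multiplicity: where no earlier step contributes, the coefficient -1 comes from the last
  step alone, whose sign is negative as \<open>m - 1\<close> is odd.\<close>

lemma count_top_syzygies:
  assumes pos: "\<forall>i\<in>{1..m}. 0 < d i" and m: "even m" "2 \<le> m"
    and sub: "\<forall>i\<in>{1..m-1}. syz_mset \<beta> C i \<subseteq># syz_mset b c i"
    and hilb: "hilbert_series (semigroup_of m d) =
      syz_numerator m \<beta> C / (\<Prod>j=1..m. 1 - fps_X ^ d j)"
  shows "int (count (syz_mset \<beta> C (m - 1)) x) =
    of_bool (x - int (gen_sum m d) \<in> pseudo_frobenius (semigroup_of m d))"
proof -
  have basis: "\<exists>j\<in>{1..b i}. x = int (c j i)"
    if "i \<in> {1..m-1}" "count (syz_mset \<beta> C i) x \<noteq> 0" for i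
  proof -
    have "x \<in># syz_mset b c i"
      using that sub mset_subset_eqD by fastforce
    then show ?thesis by (auto simp: syz_mset_def)
  qed
  show ?thesis
  proof (cases "x - int (gen_sum m d) \<in> pseudo_frobenius (semigroup_of m d)")
    case True
    have zero: "count (syz_mset \<beta> C i) x = 0" if i: "i \<in> {1..m-1}" "i \<noteq> m - 1" for i
    proof (rule ccontr)
      assume "count (syz_mset \<beta> C i) x \<noteq> 0"
      then obtain j where "j \<in> {1..b i}" "x = int (c j i)" using basis[OF i(1)] by blast
      moreover have "Suc i < m" using i by auto
      ultimately show False using basis_degree_not_pseudo_frobenius[OF pos] True by blast
    qed
    \<comment> \<open>At degree 0 the leading 1 of \<open>Q\<close> would interfere. It is excluded
      since then minus the sum of \<open>d 2\<close>, ..., \<open>d m\<close> would lie in the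
      semigroup.\<close>
    have "x \<noteq> 0"
    proof
      assume "x = 0"
      then have "degs d {1} - int (gen_sum m d) \<in> semigroup_of m d"
        using pseudo_frobenius_add_degs[OF True _ _ pos, of "{1}"] m by simp
      moreover have "degs d ({1..m} - {1}) = int (gen_sum m d) - degs d {1}"
        using m by (intro degs_complement) auto
      moreover have "0 < degs d ({1..m} - {1})"
      proof -
        have "degs d ({1..m} - {1}) = int (d 2) + degs d ({1..m} - {1} - {2})"
          using m by (intro degs_remove) auto
        moreover have "0 < d 2" using pos m by auto
        ultimately show ?thesis using degs_nonneg[of d "{1..m} - {1} - {2}"] by linarith
      qed
      ultimately show False using semigroup_nonneg by force
    qed
    then have "koszul_char m d x = (\<Sum>i=1..m-1. (-1) ^ i * int (count (syz_mset \<beta> C i) x))"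
      using koszul_char_syzygies[OF hilb pos, of x] by simp
    also have "\<dots> = (\<Sum>i=1..m-1. if i = m - 1 then (-1) ^ (m - 1) * int (count (syz_mset \<beta> C (m - 1)) x) else 0)"
      using zero by (intro sum.cong) auto
    also have "\<dots> = - int (count (syz_mset \<beta> C (m - 1)) x)"
      using m by simp
    finally show ?thesis
      using koszul_char_pseudo_frobenius[OF True pos] m True by simp
  next
    case False
    have "count (syz_mset \<beta> C (m - 1)) x = 0"
    proof (rule ccontr)
      assume "count (syz_mset \<beta> C (m - 1)) x \<noteq> 0"
      then obtain j where "j \<in> {1..b (m - 1)}" "x = int (c j (m - 1))"
        using basis[of "m - 1"] m(2) by force
      then show False using top_basis_degree_pseudo_frobenius[of j] m(2) False by simp
    qed
    with False show ?thesis by simp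
  qed
qed

end

text \<open>The two indicators never overlap: the Frobenius number is not in
  \<open>Delta_H S\<close>, because its difference with itself is 0, an element of
  \<open>S\<close>.\<close>

lemma pseudo_frobenius_almost_symmetric:
  assumes "Gcd (d ` {1..m}) = 1" "almost_symmetric (semigroup_of m d)"
  defines "S \<equiv> semigroup_of m d"
  shows "of_bool (y \<in> pseudo_frobenius S) = (of_bool (y = frobenius S) + of_bool (y \<in> Delta_H S) :: int)"
proof -
  have "frobenius S \<in> pseudo_frobenius S"
    using frobenius_props[OF assms(1)] semigroup_nonneg[of _ m d]
    by (force simp: pseudo_frobenius_def S_def)
  moreover have "frobenius S \<notin> Delta_H S"
    by (simp add: Delta_H_def S_def zero_in_semigroup)
  ultimately show ?thesis using assms(2) by (auto simp: almost_symmetric_def S_def)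
qed

lemma count_syz_bar_mset: "count (syz_bar_mset m d \<beta> C i) x = count (syz_mset \<beta> C i) (bar m d x)"
  unfolding syz_bar_mset_def syz_mset_def
    count_image_mset_set[OF finite_atLeastAtMost]
  by (rule sum.cong) (auto simp: bar_def)

lemma sum_alternating_pairs:
  fixes h :: "nat \<Rightarrow> int"
  shows "(\<Sum>i=1..2*k+1. (-1) ^ i * h i) =
    (\<Sum>i=1..k. h (2 * i)) - (\<Sum>i=1..k. h (2 * i - 1)) - h (2 * k + 1)"
  by (induction k) simp_all

theorem lemma6:
  fixes n m :: nat
    and d :: "nat \<Rightarrow> nat"
    and b \<beta> :: "nat \<Rightarrow> nat"
    and c C :: "nat \<Rightarrow> nat \<Rightarrow> nat"
    and D :: "nat \<Rightarrow> nat \<Rightarrow> nat \<Rightarrow> 'k::field_char_0 mpolynomial"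
    and B_o B_e Bbar_o Bbar_e M12 X12 :: "int multiset"
  assumes "n \<ge> 2" and "m = 2 * n"
    and "minimal_generators m d"
    and "almost_symmetric (semigroup_of m d)"
    and "syzygy_degrees m d b c D \<beta> C"
    and "B_o = (\<Sum>i=1..n-1. syz_mset \<beta> C (2 * i - 1))"
    and "B_e = (\<Sum>i=1..n-1. syz_mset \<beta> C (2 * i))"
    and "Bbar_o = (\<Sum>i=1..n-1. syz_bar_mset m d \<beta> C (2 * i - 1))"
    and "Bbar_e = (\<Sum>i=1..n-1. syz_bar_mset m d \<beta> C (2 * i))"
    and "M12 = L_even m d \<inter># L_odd m d"
    and "X12 = (B_o + Bbar_o) \<inter># (B_e + Bbar_e)"
  shows "(B_o + Bbar_o) - X12 = L_even m d - M12 \<and>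
         (B_e + Bbar_e) - X12 = L_odd m d - M12"
proof -
  let ?S = "semigroup_of m d"
  let ?F = "frobenius ?S" and ?\<Sigma> = "int (gen_sum m d)" and ?\<Delta> = "Delta_H ?S"
  let ?s = "\<lambda>i x. int (count (syz_mset \<beta> C i) x)"
  have m: "even m" "2 \<le> m" "m - 1 = 2 * (n - 1) + 1" using assms(1,2) by auto
  have pos: "\<forall>i\<in>{1..m}. 0 < d i" and gcd: "Gcd (d ` {1..m}) = 1"
    using assms(3) by (auto simp: minimal_generators_def)
  interpret graded_resolution m d b c D
    using assms(5) by unfold_locales (simp add: syzygy_degrees_def)
  have hilb: "hilbert_series ?S = syz_numerator m \<beta> C / (\<Prod>j=1..m. 1 - fps_X ^ d j)"
    and sub: "\<forall>i\<in>{1..m-1}. syz_mset \<beta> C i \<subseteq># syz_mset b c i"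
    using assms(5) by (auto simp: syzygy_degrees_def)
  have top: "?s (m - 1) y = of_bool (y - ?\<Sigma> = ?F) + of_bool (y - ?\<Sigma> \<in> ?\<Delta>)" for y
    unfolding count_top_syzygies[OF pos m(1,2) sub hilb]
    by (rule pseudo_frobenius_almost_symmetric[OF gcd assms(4)])
  \<comment> \<open>The last step \<open>m - 1 = 2 * (n - 1) + 1\<close> is split off from the odd
    ones, since \<open>B_o\<close> stops before it, and is replaced by its explicit degrees.\<close>
  have char: "koszul_char m d y = of_bool (y = 0) + (\<Sum>i=1..n-1. ?s (2 * i) y) -
      (\<Sum>i=1..n-1. ?s (2 * i - 1) y) - of_bool (y - ?\<Sigma> = ?F) - of_bool (y - ?\<Sigma> \<in> ?\<Delta>)" for y
  proof -
    have "koszul_char m d y = of_bool (y = 0) + (\<Sum>i=1..2*(n-1)+1. (-1) ^ i * ?s i y)"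
      unfolding koszul_char_syzygies[OF hilb pos] m(3) ..
    then show ?thesis
      unfolding sum_alternating_pairs unfolding m(3)[symmetric] top by simp
  qed
  have balance: "int (count (B_o + Bbar_o) x) + int (count (L_odd m d) x) =
      int (count (B_e + Bbar_e) x) + int (count (L_even m d) x)" for x
  proof -
    \<comment> \<open>When \<open>char\<close> is added at \<open>x\<close> and at
      \<open>bar m d x\<close>, the constant 1 at one point meets the last syzygy of degree
      \<open>?F + ?\<Sigma>\<close> at the other. The remaining indicators of
      \<open>?\<Delta>\<close> cancel those in \<open>koszul_char_symmetry\<close>.\<close>
    have "bar m d x = 0 \<longleftrightarrow> x - ?\<Sigma> = ?F" "bar m d x - ?\<Sigma> = ?F \<longleftrightarrow> x = 0"
      "bar m d x - ?\<Sigma> \<in> ?\<Delta> \<longleftrightarrow> x \<in> ?\<Delta>"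
      by (auto simp: bar_def Delta_H_def)
    moreover have "int (count (B_o + Bbar_o) x) =
        (\<Sum>i=1..n-1. ?s (2 * i - 1) x) + (\<Sum>i=1..n-1. ?s (2 * i - 1) (bar m d x))"
      "int (count (B_e + Bbar_e) x) =
        (\<Sum>i=1..n-1. ?s (2 * i) x) + (\<Sum>i=1..n-1. ?s (2 * i) (bar m d x))"
      unfolding assms(6-9) by (simp_all add: count_sum count_syz_bar_mset)
    ultimately show ?thesis
      using koszul_char_symmetry[OF gcd m(1), of x] m(2)
      unfolding char[of x] char[of "bar m d x"] by simp
  qed
  \<comment> \<open>Removing an intersection leaves the positive part of a difference of
    multiplicities, and \<open>balance\<close> says that the differences on the two sides
    agree.\<close>
  have "count (B_o + Bbar_o - X12) x = count (L_even m d - M12) x \<and>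
      count (B_e + Bbar_e - X12) x = count (L_odd m d - M12) x" for x
    using balance[of x] unfolding assms(10,11) by (simp only: count_diff count_inter_mset) linarith
  then show ?thesis by (simp add: multiset_eq_iff)
qed

end
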